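(* Let $n\geq 2$ be an integer and let $\alpha\in\mathbb{R}^n\setminus\{0\}$ be a vector having at least one component equal to $1$. Let $F_\alpha$ be the smallest rational subspace of $\mathbb{R}^n$ containing $\alpha$, $d=\dim F_\alpha$ (so $1\leq d\leq n$), $\Lambda_\alpha=F_\alpha\cap\mathbb{Z}^n$, and let $Q_\alpha$, $C_\alpha$, $\Psi_\alpha$ and the $\delta$-ergodization time $T_\alpha(\delta)$ be as defined in the context. Let $\delta>0$ be such that $$\delta\leq \frac{d^2}{(n+2)Q_\alpha}.$$ Then $$T_\alpha(\delta)\leq C_{d,\alpha}\,\Psi_\alpha\left(2C_{d,\alpha}\,\delta^{-1}\right),\qquad\text{where } C_{d,\alpha}:=d^2\,d!\,C_\alpha .$$
   Context: A vector subspace of $\mathbb{R}^n$ is called rational if it admits a basis of vectors with rational components. $F_\alpha$ denotes the smallest rational subspace of $\mathbb{R}^n$ containing $\alpha$, and $d$ its dimension; $\Lambda_\alpha:=F_\alpha\cap\mathbb{Z}^n$ is a lattice in $F_\alpha$. For $k=(k_1,\dots,k_n)$ and $\alpha=(\alpha_1,\dots,\alpha_n)$ write $k\cdot\alpha=k_1\alpha_1+\cdots+k_n\alpha_n$. Throughout, $|x|=\max\{|x_1|,\dots,|x_n|\}$ is the sup norm on $\mathbb{R}^n$. Lattice constants: $Q_\alpha:=\inf\{|k| : k\in\Lambda_\alpha\setminus\{0\}\}$, and $C_\alpha:=|\Lambda_\alpha|^2$, where $|\Lambda_\alpha|$ is the co-volume of $\Lambda_\alpha$, i.e. the ($d$-dimensional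 Euclidean) volume of a fundamental domain of $F_\alpha/\Lambda_\alpha$, with $F_\alpha$ carrying the Euclidean structure induced from $\mathbb{R}^n$. For real $Q\geq Q_\alpha$, define $$\Psi_\alpha(Q):=\max\{|k\cdot\alpha|^{-1} : k\in\Lambda_\alpha,\ 0<|k|\leq Q\}.$$ Ergodization time: let $\mathcal{T}^d_\alpha:=F_\alpha/\Lambda_\alpha$ ($d$-dimensional torus, contained in $\mathbb{T}^n=\mathbb{R}^n/\mathbb{Z}^n$), with the metric induced by the sup norm restricted to $F_\alpha$, that is, the distance between the classes of $x,y\in F_\alpha$ is $\min_{\lambda\in\Lambda_\alpha}|x-y-\lambda|$. The linear flow is $X_\alpha^t(\theta)=\theta+t\alpha$ for $t\in\mathbb{R}$. For $T>0$ put $\mathcal{O}_\alpha^T:=\bigcup_{0\leq t\leq T}X_\alpha^t(0)\subset\mathcal{T}_\alpha^d$. A subset of a metric space is $\delta$-dense if every point of the space is at distance at most $\delta$ from some point of the subset. The $\delta$-ergodization time $T_\alpha(\delta)$ is the smallest time $T>0$ (understood as the infimum of such times) for which $\mathcal{O}_\alpha^{T}$ is a $\delta$-dense subset of $\mathcal{T}_\alpha^d$. *)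

theory Defs
  imports "HOL-Analysis.Analysis"
begin

text \<open>The sup norm on \<^typ>\<open>real ^ 'n\<close> is the library's \<^const>\<open>infnorm\<close> (see the
  lemma infnorm_cart); the scalar product is \<^const>\<open>inner\<close>.\<close>

definition rational_subspace :: "(real ^ 'n) set \<Rightarrow> bool" where
  "rational_subspace F \<longleftrightarrow>
     (\<exists>B. independent B \<and> span B = F \<and> (\<forall>b\<in>B. \<forall>i. b $ i \<in> \<rat>))"

text \<open>Rational subspaces are closed under intersection, so the hull is itself rational
  and hence the smallest rational subspace containing \<open>\<alpha>\<close>.\<close>

definition rat_hull :: "real ^ 'n \<Rightarrow> (real ^ 'n) set" where
  "rat_hull \<alpha> = rational_subspace hull {\<alpha>}"

definition rat_lattice :: "real ^ 'n \<Rightarrow> (real ^ 'n) set" where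
  "rat_lattice \<alpha> = rat_hull \<alpha> \<inter> {k. \<forall>i. k $ i \<in> \<int>}"

definition min_lattice_norm :: "real ^ 'n \<Rightarrow> real" where
  "min_lattice_norm \<alpha> = (INF k \<in> rat_lattice \<alpha> - {0}. infnorm k)"

definition orthonormal_basis_of :: "'a::euclidean_space set \<Rightarrow> 'a set \<Rightarrow> bool" where
  "orthonormal_basis_of F E \<longleftrightarrow> pairwise orthogonal E \<and> (\<forall>e\<in>E. norm e = 1) \<and> span E = F"

text \<open>Lebesgue measure of dimension \<open>dim F\<close> on a subspace \<open>F\<close> with the induced Euclidean
  structure, as a measure on the ambient space concentrated on \<open>F\<close>. The construction follows
  that of \<^const>\<open>lborel\<close>, with \<^const>\<open>Basis\<close> replaced by an orthonormal basis of \<open>F\<close>; by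
  rotation invariance the choice of the basis is immaterial.\<close>

definition subspace_lborel :: "'a::euclidean_space set \<Rightarrow> 'a measure" where
  "subspace_lborel F =
     (let E = (SOME E. orthonormal_basis_of F E)
      in distr (\<Pi>\<^sub>M e\<in>E. (lborel :: real measure)) borel (\<lambda>f. \<Sum>e\<in>E. f e *\<^sub>R e))"

definition fundamental_domain :: "'a::euclidean_space set \<Rightarrow> 'a set \<Rightarrow> 'a set \<Rightarrow> bool" where
  "fundamental_domain F L D \<longleftrightarrow>
     D \<in> sets borel \<and> D \<subseteq> F \<and> (\<forall>x\<in>F. \<exists>!l. l \<in> L \<and> x - l \<in> D)"

text \<open>For a lattice \<open>L\<close> of full rank in \<open>F\<close>, all Borel fundamental domains have the same
  volume, so the choice is again immaterial.\<close>

definition covolume :: "'a::euclidean_space set \<Rightarrow> 'a set \<Rightarrow> real" where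
  "covolume F L = measure (subspace_lborel F) (SOME D. fundamental_domain F L D)"

definition lattice_const :: "real ^ 'n \<Rightarrow> real" where
  "lattice_const \<alpha> = (covolume (rat_hull \<alpha>) (rat_lattice \<alpha>))\<^sup>2"

text \<open>Meaningful for \<open>Q \<ge> min_lattice_norm \<alpha>\<close>: then the set below is finite and nonempty,
  and \<open>k \<bullet> \<alpha> \<noteq> 0\<close> for all nonzero \<open>k\<close> in the lattice.\<close>

definition Psi :: "real ^ 'n \<Rightarrow> real \<Rightarrow> real" where
  "Psi \<alpha> Q = Max {inverse \<bar>k \<bullet> \<alpha>\<bar> | k. k \<in> rat_lattice \<alpha> \<and> 0 < infnorm k \<and> infnorm k \<le> Q}"

definition torus_rel :: "real ^ 'n \<Rightarrow> ((real ^ 'n) \<times> (real ^ 'n)) set" where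
  "torus_rel \<alpha> = {(x, y). x \<in> rat_hull \<alpha> \<and> y \<in> rat_hull \<alpha> \<and> x - y \<in> rat_lattice \<alpha>}"

definition torus :: "real ^ 'n \<Rightarrow> (real ^ 'n) set set" where
  "torus \<alpha> = rat_hull \<alpha> // torus_rel \<alpha>"

text \<open>Letting \<open>x\<close> and \<open>y\<close> range over the two classes only repeats the values obtained from one
  pair of representatives.\<close>

definition torus_dist :: "real ^ 'n \<Rightarrow> (real ^ 'n) set \<Rightarrow> (real ^ 'n) set \<Rightarrow> real" where
  "torus_dist \<alpha> A B =
     Inf {infnorm (x - y - l) | x y l. x \<in> A \<and> y \<in> B \<and> l \<in> rat_lattice \<alpha>}"

definition linear_flow :: "real ^ 'n \<Rightarrow> real \<Rightarrow> (real ^ 'n) set \<Rightarrow> (real ^ 'n) set" where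
  "linear_flow \<alpha> t A = (\<lambda>\<theta>. \<theta> + t *\<^sub>R \<alpha>) ` A"

definition flow_orbit :: "real ^ 'n \<Rightarrow> real \<Rightarrow> (real ^ 'n) set set" where
  "flow_orbit \<alpha> T = (\<Union>t\<in>{0..T}. {linear_flow \<alpha> t (torus_rel \<alpha> `` {0})})"

definition delta_dense :: "'p set \<Rightarrow> ('p \<Rightarrow> 'p \<Rightarrow> real) \<Rightarrow> real \<Rightarrow> 'p set \<Rightarrow> bool" where
  "delta_dense X D \<delta> S \<longleftrightarrow> S \<subseteq> X \<and> (\<forall>x\<in>X. \<exists>y\<in>S. D x y \<le> \<delta>)"

definition ergodization_time :: "real ^ 'n \<Rightarrow> real \<Rightarrow> real" where
  "ergodization_time \<alpha> \<delta> =
     Inf {T. T > 0 \<and> delta_dense (torus \<alpha>) (torus_dist \<alpha>) \<delta> (flow_orbit \<alpha> T)}"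

definition dim_const :: "real ^ 'n \<Rightarrow> real" where
  "dim_const \<alpha> =
     (real (dim (rat_hull \<alpha>)))\<^sup>2 * fact (dim (rat_hull \<alpha>)) * lattice_const \<alpha>"

end

(* The time-T orbit is delta-dense iff the symmetric convex body
   K = {t alpha + y : |t| <= T/2, y in F, |y| <= delta} satisfies K + Lambda = F.  By a transference
   principle this holds as soon as every nonzero y in the dual lattice Lambda* satisfies y . k >= H for
   some k in K, where (3^d - 1)/4 <= H; here H = d^2 d!/2.  The principle is proved by
   induction on the codimension of a subspace W spanned by lattice vectors: a lattice vector nearly
   closest to W is close to W, because otherwise a lattice vector close to the next larger subspace
   could be rounded to one much closer to W; in codimension one, the dual vector orthogonal to W gives
   the estimate.
   Since C_alpha is the Gram determinant of a Z-basis of Lambda, Cramer's rule gives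
   C_alpha Lambda* <= Lambda.  So for y in Lambda* the vector k = C_alpha y enters the definition of
   Psi_alpha(Q), Q = 2 C_{d,alpha}/delta: if |k| <= Q, then k . alpha is bounded below and the
   direction alpha of K is long enough; otherwise y itself is long, and the delta-ball of K suffices. *)

theory Submission
  imports Defs
begin

section \<open>Integral lattices\<close>

text \<open>The constants come from rounding. If a lattice vector v lies at distance t from W,
  moving a coefficient along v to the nearest integer costs at most t / 2. With distances 3^i / H in
  codimension i + 1 these costs add up to (3^d - 1) / (4 * H), and K covers as soon as the sum is at
  most 1. Write D for the constant d^2 d! C_alpha. H equals D / (2 * C_alpha) because K extends only
  T / 2 to either side in time, with T = D * Psi(Q). Two obstacles shape the rest. And the covolume
  is defined by two arbitrary choices, an orthonormal basis and a fundamental domain. The first is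
  absorbed by building all coordinates on the chosen basis itself, the second by cutting one domain
  into pieces and translating them into the other.\<close>

locale integral_lattice =
  fixes L :: "'a::euclidean_space set"
  assumes zero_mem: "0 \<in> L"
    and diff_mem: "x \<in> L \<Longrightarrow> y \<in> L \<Longrightarrow> x - y \<in> L"
    and inner_Ints: "x \<in> L \<Longrightarrow> y \<in> L \<Longrightarrow> x \<bullet> y \<in> \<int>"
begin

lemma minus_mem: "x \<in> L \<Longrightarrow> - x \<in> L"
  using diff_mem[OF zero_mem] by simp

lemma add_mem: "x \<in> L \<Longrightarrow> y \<in> L \<Longrightarrow> x + y \<in> L"
  using diff_mem[of x "- y"] minus_mem by simp

lemma scaleR_mem:
  assumes "x \<in> L" "c \<in> \<int>"
  shows "c *\<^sub>R x \<in> L"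
proof -
  have nat: "real n *\<^sub>R x \<in> L" for n
    by (induction n) (auto simp: zero_mem scaleR_add_left add_mem assms(1))
  from assms(2) obtain j :: int where j: "c = of_int j"
    by (auto elim: Ints_cases)
  show ?thesis
  proof (cases "j \<ge> 0")
    case True
    then show ?thesis using nat[of "nat j"] j by simp
  next
    case False
    then have "c = - real (nat (- j))" using j by simp
    then show ?thesis using minus_mem[OF nat[of "nat (- j)"]] by simp
  qed
qed

lemma sum_mem: "(\<And>i. i \<in> A \<Longrightarrow> f i \<in> L) \<Longrightarrow> sum f A \<in> L"
  by (induction A rule: infinite_finite_induct) (auto simp: zero_mem add_mem)

text \<open>Gram-Schmidt without division: after multiplication by N, the product of all c . c, the
  projection of v has the coefficients N (v . c) / (c . c), which are integers, so u stays in
  L.\<close>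

lemma orthogonal_step:
  assumes "finite C" "C \<subseteq> L" "0 \<notin> C" "pairwise orthogonal C" "v \<in> L"
  obtains u where "u \<in> L" "\<And>c. c \<in> C \<Longrightarrow> orthogonal u c"
    "u \<in> span (insert v C)" "v \<in> span (insert u C)"
proof -
  define N where "N = (\<Prod>c\<in>C. c \<bullet> c)"
  define p where "p = (\<Sum>c\<in>C. (N * (v \<bullet> c) / (c \<bullet> c)) *\<^sub>R c)"
  define u where "u = N *\<^sub>R v - p"
  have N0: "N \<noteq> 0" using assms(1,3) by (auto simp: N_def)
  have NI: "N \<in> \<int>" unfolding N_def using assms(2) inner_Ints by (auto intro!: Ints_prod)
  have cI: "N * (v \<bullet> c) / (c \<bullet> c) \<in> \<int>" if "c \<in> C" for c
  proof -
    have "N = (c \<bullet> c) * (\<Prod>c\<in>C - {c}. c \<bullet> c)"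
      unfolding N_def using assms(1) that by (simp add: prod.remove)
    moreover have "c \<bullet> c \<noteq> 0" using that assms(3) by auto
    ultimately have "N * (v \<bullet> c) / (c \<bullet> c) = (\<Prod>c\<in>C - {c}. c \<bullet> c) * (v \<bullet> c)" by simp
    also have "\<dots> \<in> \<int>" using that assms inner_Ints by (intro Ints_mult Ints_prod) auto
    finally show ?thesis .
  qed
  have p_span: "p \<in> span C" unfolding p_def by (auto intro!: span_sum span_scale intro: span_base)
  have u: "u \<in> L" unfolding u_def p_def
    using assms cI by (intro diff_mem scaleR_mem sum_mem NI) auto
  have orth: "orthogonal u c" if "c \<in> C" for c
  proof -
    have "p \<bullet> c = (\<Sum>e\<in>C. N * (v \<bullet> e) / (e \<bullet> e) * (e \<bullet> c))"
      unfolding p_def by (simp add: inner_sum_left)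
    also have "\<dots> = (\<Sum>e\<in>C. if e = c then N * (v \<bullet> c) else 0)"
      using assms(3,4) that by (intro sum.cong) (auto simp: pairwise_def orthogonal_def)
    also have "\<dots> = N * (v \<bullet> c)" using assms(1) that by simp
    finally show ?thesis by (simp add: orthogonal_def u_def inner_diff_left)
  qed
  have "p \<in> span (insert v C)" "p \<in> span (insert u C)"
    using p_span span_mono[of C "insert v C"] span_mono[of C "insert u C"] by auto
  then have 1: "u \<in> span (insert v C)" and 2: "p + u \<in> span (insert u C)"
    using span_diff[of "N *\<^sub>R v" "insert v C" p] span_add[of p "insert u C" u]
    by (auto simp: u_def intro: span_scale span_base)
  have "v = (1 / N) *\<^sub>R (p + u)" using N0 by (simp add: u_def)
  with 2 have "v \<in> span (insert u C)" by (metis span_scale)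
  with u orth 1 that show thesis by blast
qed

text \<open>With C = {} this turns a spanning set into an orthogonal one inside L. With C given, D -
  C spans the part of the whole span that is orthogonal to C.\<close>

lemma orthogonal_extension_in:
  assumes "finite B" "B \<subseteq> L" "finite C" "C \<subseteq> L" "0 \<notin> C" "pairwise orthogonal C"
  shows "\<exists>D. finite D \<and> C \<subseteq> D \<and> D \<subseteq> L \<and> 0 \<notin> D \<and> pairwise orthogonal D \<and> span D = span (C \<union> B)"
  using assms(1,2)
proof (induction B)
  case empty
  then show ?case using assms by auto
next
  case (insert v B)
  then obtain D where D: "finite D" "C \<subseteq> D" "D \<subseteq> L" "0 \<notin> D" "pairwise orthogonal D"
    "span D = span (C \<union> B)" by auto
  obtain u where u: "u \<in> L" "\<And>c. c \<in> D \<Longrightarrow> orthogonal u c"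
    "u \<in> span (insert v D)" "v \<in> span (insert u D)"
    using orthogonal_step[OF D(1,3,4,5)] insert.prems by (metis insert_subset)
  have "span (C \<union> insert v B) = span (insert v (C \<union> B))" by simp
  also have "\<dots> = span (insert v D)" using D(6) by (simp add: span_insert)
  also have "\<dots> = span (insert u D)"
    using u(3,4) by (intro span_eq[THEN iffD2] conjI) (auto intro: span_base)
  finally have sp: "span (C \<union> insert v B) = span (insert u D)" .
  show ?case
  \<comment> \<open>u = 0 means that v already lies in \<open>span D\<close>, so D serves
    unchanged.\<close>
  proof (cases "u = 0")
    case True
    then show ?thesis using D sp by (intro exI[of _ D]) (simp add: span_insert_0)
  next
    case False
    then show ?thesis
      using D sp u(1,2)
      by (intro exI[of _ "insert u D"]) (auto simp: pairwise_insert orthogonal_commute)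
  qed
qed

end

text \<open>Write x = u + w with u in \<open>span C\<close> and w in \<open>span (D - C)\<close>.
  Both x and w are orthogonal to u, hence so is u itself, and u = 0.\<close>

lemma orthogonal_span_split:
  fixes D :: "'a::euclidean_space set"
  assumes "pairwise orthogonal D" "C \<subseteq> D"
    "x \<in> span D" "\<And>c. c \<in> C \<Longrightarrow> orthogonal x c"
  shows "x \<in> span (D - C)"
proof -
  have "C \<union> (D - C) = D" using assms by auto
  then have "x \<in> span (C \<union> (D - C))" using assms(3) by simp
  then obtain u w where uw: "x = u + w" "u \<in> span C" "w \<in> span (D - C)"
    unfolding span_Un by blast
  have xu: "orthogonal x u" using assms(4) uw(2) by (meson orthogonal_to_span)
  have "orthogonal c w" if c: "c \<in> C" for c
  proof (rule orthogonal_to_span[OF uw(3)])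
    fix y assume "y \<in> D - C"
    then show "orthogonal c y" using assms(1,2) c by (metis DiffE pairwiseD subsetD)
  qed
  then have "orthogonal w u" using uw(2) by (intro orthogonal_to_span[of u C]) (auto simp: orthogonal_commute)
  with xu have "u = 0" unfolding uw(1) by (simp add: orthogonal_def inner_add_left)
  with uw show ?thesis by simp
qed

section \<open>Transference for symmetric convex bodies\<close>

text \<open>Distance at most s from W in the gauge of K, written as a relation so that no infimum
  over W or K has to be attained.\<close>

definition reach :: "'a::real_vector set \<Rightarrow> 'a set \<Rightarrow> real \<Rightarrow> 'a \<Rightarrow> bool" where
  "reach K W s x \<longleftrightarrow> (\<exists>w\<in>W. \<exists>k\<in>K. x = w + s *\<^sub>R k)"

locale symmetric_convex =
  fixes K :: "'a::real_vector set"
  assumes convex_K: "convex K" and sym_K: "x \<in> K \<Longrightarrow> - x \<in> K" and K_ne: "K \<noteq> {}"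
begin

lemma scale_mem: "k \<in> K \<Longrightarrow> \<bar>c\<bar> \<le> 1 \<Longrightarrow> c *\<^sub>R k \<in> K"
proof -
  assume k: "k \<in> K" and c: "\<bar>c\<bar> \<le> 1"
  have "((1 + c) / 2) *\<^sub>R k + ((1 - c) / 2) *\<^sub>R (- k) \<in> K"
    using k c sym_K by (intro convexD[OF convex_K]) (auto simp: field_simps)
  also have "((1 + c) / 2) *\<^sub>R k + ((1 - c) / 2) *\<^sub>R (- k) = ((1 + c) / 2 - (1 - c) / 2) *\<^sub>R k"
    by (simp add: algebra_simps)
  also have "(1 + c) / 2 - (1 - c) / 2 = c" by (simp add: field_simps)
  finally show ?thesis .
qed

lemma reach_0: "x \<in> W \<Longrightarrow> reach K W 0 x"
  using K_ne by (auto simp: reach_def)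

lemma reach_scale:
  assumes "subspace W" "reach K W s x" "s \<ge> 0" "\<bar>c\<bar> * s \<le> t"
  shows "reach K W t (c *\<^sub>R x)"
proof (cases "t = 0")
  case True
  from assms obtain w k where x: "x = w + s *\<^sub>R k" "w \<in> W" "k \<in> K" by (auto simp: reach_def)
  have "c * s = 0" using True assms(3,4) by (smt (verit) mult_eq_0_iff mult_nonneg_nonneg)
  then have "c *\<^sub>R x = c *\<^sub>R w + t *\<^sub>R k" using True x by (simp add: scaleR_add_right)
  then show ?thesis using x assms(1) by (auto simp: reach_def subspace_scale)
next
  case False
  then have t: "t > 0" using assms(3,4) by (smt (verit) mult_nonneg_nonneg)
  from assms obtain w k where x: "x = w + s *\<^sub>R k" "w \<in> W" "k \<in> K" by (auto simp: reach_def)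
  have "\<bar>c * s / t\<bar> \<le> 1" using assms(3,4) t by (simp add: abs_mult)
  then have "(c * s / t) *\<^sub>R k \<in> K" using x scale_mem by blast
  moreover have "c *\<^sub>R x = c *\<^sub>R w + t *\<^sub>R ((c * s / t) *\<^sub>R k)"
    using x t by (simp add: scaleR_add_right)
  ultimately show ?thesis using x assms(1) unfolding reach_def by (blast intro: subspace_scale)
qed

lemma reach_mono: "subspace W \<Longrightarrow> reach K W s x \<Longrightarrow> 0 \<le> s \<Longrightarrow> s \<le> t \<Longrightarrow> reach K W t x"
  using reach_scale[of W s x 1 t] by simp

text \<open>The triangle inequality of the gauge: s k + t k' is s + t times a convex combination of
  k and k'.\<close>

lemma reach_add:
  assumes "subspace W" "reach K W s x" "reach K W t y" "s \<ge> 0" "t \<ge> 0"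
  shows "reach K W (s + t) (x + y)"
proof (cases "s + t = 0")
  case True
  then have "s = 0" "t = 0" using assms by auto
  then show ?thesis using assms K_ne by (auto simp: reach_def subspace_add)
next
  case False
  then have st: "s + t > 0" using assms by auto
  from assms obtain w k where x: "x = w + s *\<^sub>R k" "w \<in> W" "k \<in> K" by (auto simp: reach_def)
  from assms obtain w' k' where y: "y = w' + t *\<^sub>R k'" "w' \<in> W" "k' \<in> K" by (auto simp: reach_def)
  have "(s / (s + t)) *\<^sub>R k + (t / (s + t)) *\<^sub>R k' \<in> K"
    using x y assms st by (intro convexD[OF convex_K]) (auto simp: add_divide_distrib[symmetric])
  moreover have "x + y = (w + w') + (s + t) *\<^sub>R ((s / (s + t)) *\<^sub>R k + (t / (s + t)) *\<^sub>R k')"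
    using x y st by (simp add: scaleR_add_right)
  ultimately show ?thesis using x y assms(1) unfolding reach_def by (blast intro: subspace_add)
qed

text \<open>The rounding step. The point of \<open>span (insert v W)\<close> near x has some real
  coefficient c along v; replacing c by the nearest integer j leaves at most half of v, hence the
  additional t / 2.\<close>

lemma reach_insert:
  assumes "reach K (span (insert v W)) s x" "reach K (span W) t v" "s \<ge> 0" "t \<ge> 0"
  obtains j :: int where "reach K (span W) (s + t / 2) (x - of_int j *\<^sub>R v)"
proof -
  from assms(1) obtain w' k where x: "x = w' + s *\<^sub>R k" "w' \<in> span (insert v W)" "k \<in> K"
    by (auto simp: reach_def)
  then obtain c where c: "w' - c *\<^sub>R v \<in> span W" by (auto simp: span_insert)
  define j where "j = round c"
  have "\<bar>c - of_int j\<bar> \<le> 1 / 2" unfolding j_def using of_int_round_abs_le[of c] by linarith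
  then have "\<bar>c - of_int j\<bar> * t \<le> (1 / 2) * t" using assms(4) by (rule mult_right_mono)
  then have 1: "reach K (span W) (t / 2) ((c - of_int j) *\<^sub>R v)"
    using assms by (intro reach_scale[OF subspace_span assms(2)]) auto
  have "reach K (span W) s (x - c *\<^sub>R v)"
    using c x unfolding reach_def
    by (intro bexI[of _ "w' - c *\<^sub>R v"] bexI[of _ k]) (auto simp: algebra_simps)
  from reach_add[OF subspace_span this 1] assms
  have "reach K (span W) (s + t / 2) ((x - c *\<^sub>R v) + (c - of_int j) *\<^sub>R v)" by simp
  also have "(x - c *\<^sub>R v) + (c - of_int j) *\<^sub>R v = x - of_int j *\<^sub>R v" by (simp add: algebra_simps)
  finally show thesis by (rule that)
qed

end

text \<open>By symmetry of K, \<open>wide\<close> says that K has width at least 2 * H along every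
  nonzero vector of the dual lattice. \<open>absorbing\<close> makes every gauge distance
  finite.\<close>

locale lattice_body = integral_lattice L + symmetric_convex K
  for L K :: "'a::euclidean_space set" +
  fixes H :: real
  assumes H_pos: "H > 0"
    and K_sub: "K \<subseteq> span L"
    and absorbing: "x \<in> span L \<Longrightarrow> \<exists>s\<ge>0. \<exists>k\<in>K. x = s *\<^sub>R k"
    and wide: "y \<in> span L \<Longrightarrow> y \<noteq> 0 \<Longrightarrow> (\<forall>l\<in>L. y \<bullet> l \<in> \<int>) \<Longrightarrow> \<exists>k\<in>K. H \<le> y \<bullet> k"
begin

lemma ex_outside: "W \<subseteq> L \<Longrightarrow> dim (span W) < dim (span L) \<Longrightarrow> \<exists>v\<in>L. v \<notin> span W"
  by (metis dim_span dim_subset not_less subsetI)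

text \<open>Take u in L orthogonal to W and divide it by g, the generator of the group of its values
  on L. The quotient y is a dual vector with value 1 at some lattice vector z. If k in K has y . k
  >= H, then z - k / (y . k) is killed by y, so it lies in \<open>span W\<close>, and z is within 1
  / H of it.\<close>

lemma reach_hyperplane:
  assumes W: "W \<subseteq> L" and dim: "dim (span L) = Suc (dim (span W))"
  shows "\<exists>v\<in>L - span W. reach K (span W) (1 / H) v"
proof -
  obtain B where B: "B \<subseteq> W" "independent B" "span B = span W"
    by (metis basis_exists dim_span span_eq span_span subset_antisym span_mono span_minimal subspace_span)
  then have "finite B" "B \<subseteq> L" using W by (auto intro: independent_imp_finite)
  from orthogonal_extension_in[OF this, of "{}"] B(3)
  obtain C where C: "finite C" "C \<subseteq> L" "0 \<notin> C" "pairwise orthogonal C" "span C = span W"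
    by auto
  obtain v where v: "v \<in> L" "v \<notin> span W" using ex_outside[OF W] dim by auto
  obtain u where u: "u \<in> L" "\<And>c. c \<in> C \<Longrightarrow> orthogonal u c" "v \<in> span (insert u C)"
    using orthogonal_step[OF C(1-4) v(1)] by metis
  have u0: "u \<noteq> 0" using u(3) v(2) C(5) by (auto simp: span_insert_0)
  have uW: "orthogonal u w" if "w \<in> span W" for w
    using that u(2) unfolding C(5)[symmetric] by (meson orthogonal_to_span)
  \<comment> \<open>The kernel of u in \<open>span L\<close> contains \<open>span W\<close> and is a
    proper subspace; codimension one leaves no room between them.\<close>
  have hyper: "x \<in> span W" if "x \<in> span L" "u \<bullet> x = 0" for x
  proof -
    have sub: "span W \<subseteq> {x \<in> span L. u \<bullet> x = 0}"
      using span_mono[OF W] uW by (auto simp: orthogonal_def)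
    have ss: "subspace {x \<in> span L. u \<bullet> x = 0}"
      using subspace_inter[OF subspace_span subspace_hyperplane] by (simp add: Int_def)
    have "u \<notin> {x \<in> span L. u \<bullet> x = 0}" "u \<in> span L" using u0 u(1) by (auto intro: span_base)
    then have "{x \<in> span L. u \<bullet> x = 0} \<subset> span L" by blast
    then have "dim {x \<in> span L. u \<bullet> x = 0} < dim (span L)"
      using ss by (intro dim_psubset) (metis span_eq_iff subspace_span)
    then have "dim {x \<in> span L. u \<bullet> x = 0} \<le> dim (span W)" using dim by simp
    then have "span W = {x \<in> span L. u \<bullet> x = 0}"
      using sub ss by (metis subspace_dim_equal subspace_span)
    then show ?thesis using that by auto
  qed
  define P where "P = (\<lambda>g. g > 0 \<and> (\<exists>l\<in>L. u \<bullet> l = real g))"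
  obtain m where m: "u \<bullet> u = of_int m" using inner_Ints[OF u(1) u(1)] by (auto elim: Ints_cases)
  then have "m > 0" using u0 by (metis inner_gt_zero_iff of_int_0_less_iff)
  then have "P (nat m)" using u(1) m unfolding P_def by auto
  \<comment> \<open>The least positive value generates the group of values: a remainder modulo g is
    again a value of u on L.\<close>
  define g where "g = (LEAST g. P g)"
  have "P g" unfolding g_def using \<open>P (nat m)\<close> by (rule LeastI)
  then obtain z where z: "z \<in> L" "u \<bullet> z = real g" and g: "g > 0" by (auto simp: P_def)
  have mult: "u \<bullet> l / real g \<in> \<int>" if l: "l \<in> L" for l
  proof -
    obtain a where a: "u \<bullet> l = of_int a" using inner_Ints[OF u(1) l] by (auto elim: Ints_cases)
    define r where "r = a mod int g"
    have l': "l - of_int (a div int g) *\<^sub>R z \<in> L" using l z by (intro diff_mem scaleR_mem) auto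
    have "u \<bullet> (l - of_int (a div int g) *\<^sub>R z) = of_int (a - (a div int g) * int g)"
      using a z by (simp add: inner_diff_right)
    also have "a - (a div int g) * int g = r" unfolding r_def by (simp add: minus_div_mult_eq_mod)
    finally have ul: "u \<bullet> (l - of_int (a div int g) *\<^sub>R z) = of_int r" .
    have "r \<ge> 0" "r < int g" using g by (auto simp: r_def)
    have "r = 0"
    proof (rule ccontr)
      assume "r \<noteq> 0"
      then have "P (nat r)" using \<open>r \<ge> 0\<close> ul l' unfolding P_def by (auto intro!: bexI[OF _ l'])
      then have "g \<le> nat r" unfolding g_def by (rule Least_le)
      then show False using \<open>r < int g\<close> \<open>r \<ge> 0\<close> by linarith
    qed
    then have "int g dvd a" by (auto simp: r_def)
    then show ?thesis using a g by (auto elim!: dvdE)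
  qed
  define y where "y = (1 / real g) *\<^sub>R u"
  have y: "y \<in> span L" "y \<noteq> 0" "\<forall>l\<in>L. y \<bullet> l \<in> \<int>"
    using u(1) u0 g mult by (auto simp: y_def intro: span_scale span_base)
  from wide[OF this] obtain k where k: "k \<in> K" "H \<le> y \<bullet> k" by auto
  have yz: "y \<bullet> z = 1" using z g by (simp add: y_def)
  have yk: "y \<bullet> k > 0" using k H_pos by linarith
  define w where "w = z - (1 / (y \<bullet> k)) *\<^sub>R k"
  have "y \<bullet> w = 0" using yz yk by (simp add: w_def inner_diff_right)
  then have "u \<bullet> w = 0" using g by (simp add: y_def)
  moreover have "w \<in> span L" unfolding w_def
    using z k K_sub by (intro span_diff span_scale) (auto intro: span_base)
  ultimately have "w \<in> span W" using hyper by blast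
  then have "reach K (span W) (1 / (y \<bullet> k)) z"
    using k unfolding reach_def by (intro bexI[of _ w] bexI[of _ k]) (auto simp: w_def)
  from reach_mono[OF subspace_span this, of "1 / H"]
  have "reach K (span W) (1 / H) z" using yk k H_pos by (auto simp: frac_le)
  moreover have "z \<notin> span W" using uW[of z] z g by (auto simp: orthogonal_def)
  ultimately show ?thesis using z(1) by blast
qed

text \<open>The factor 3 (instead of 2, the bound for a vector closest to the span of \<open>W\<close>) leaves room to
  work with a vector that is closest up to steps of \<open>a / 2\<close>, so that no minimum need be attained.\<close>

lemma reach_halving:
  assumes W: "W \<subseteq> L" and dim: "dim (span W) < dim (span L)" and a: "a > 0"
    and IH: "\<And>v. v \<in> L - span W \<Longrightarrow>
      \<exists>v'\<in>L - span (insert v W). reach K (span (insert v W)) a v'"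
  shows "\<exists>v\<in>L - span W. reach K (span W) (3 * a) v"
proof -
  define P where "P = (\<lambda>n::nat. \<exists>v\<in>L - span W. reach K (span W) (real n * (a / 2)) v)"
  obtain v0 where v0: "v0 \<in> L" "v0 \<notin> span W" using ex_outside[OF W dim] by auto
  obtain s k where s: "s \<ge> 0" "k \<in> K" "v0 = s *\<^sub>R k" using absorbing span_base v0(1) by metis
  then have rs: "reach K (span W) s v0" unfolding reach_def
    by (intro bexI[of _ 0] bexI[of _ k]) (auto simp: span_zero)
  obtain n0 :: nat where "s / (a / 2) \<le> real n0" using real_arch_simple by blast
  then have "s \<le> real n0 * (a / 2)" using a by (simp add: field_simps)
  with reach_mono[OF subspace_span rs] s have "reach K (span W) (real n0 * (a / 2)) v0" by blast
  then have "P n0" unfolding P_def using v0 by blast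
  define N where "N = (LEAST n. P n)"
  have "P N" unfolding N_def using \<open>P n0\<close> by (rule LeastI)
  then obtain v where v: "v \<in> L" "v \<notin> span W" "reach K (span W) (real N * (a / 2)) v"
    by (auto simp: P_def)
  \<comment> \<open>Six steps of a / 2 make 3 * a. For larger N, a + N * a / 4 <= (N - 1) * a / 2,
    so rounding v' along v would give a lattice vector with fewer steps. It is not in
    \<open>span W\<close> because v' is not in \<open>span (insert v W)\<close>.\<close>
  have "N \<le> 6"
  proof (rule ccontr)
    assume "\<not> N \<le> 6"
    then have N: "real N \<ge> 7" by simp
    obtain v' where v': "v' \<in> L" "v' \<notin> span (insert v W)" "reach K (span (insert v W)) a v'"
      using IH[of v] v by auto
    obtain j :: int where j: "reach K (span W) (a + real N * (a / 2) / 2) (v' - of_int j *\<^sub>R v)"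
      using reach_insert[OF v'(3) v(3)] a by auto
    have "a * 6 \<le> a * real N" using a N by (intro mult_left_mono) auto
    then have "a + real N * (a / 2) / 2 \<le> real (N - 1) * (a / 2)"
      using N by (simp add: of_nat_diff field_simps)
    with j have r: "reach K (span W) (real (N - 1) * (a / 2)) (v' - of_int j *\<^sub>R v)"
      using a by (intro reach_mono[OF subspace_span j]) auto
    have "v' - of_int j *\<^sub>R v \<notin> span W" using v'(2) by (auto simp: span_insert)
    moreover have "v' - of_int j *\<^sub>R v \<in> L" using v' v by (intro diff_mem scaleR_mem) auto
    ultimately have "P (N - 1)" using r unfolding P_def by blast
    then have "N \<le> N - 1" unfolding N_def by (rule Least_le)
    then show False using N by simp
  qed
  then have "real N * (a / 2) \<le> 6 * (a / 2)" using a by (intro mult_right_mono) auto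
  then have "reach K (span W) (3 * a) v" using a by (intro reach_mono[OF subspace_span v(3)]) auto
  then show ?thesis using v by auto
qed

text \<open>Both claims share one induction on the codimension: the near vector v of the first
  serves as rounding direction in the second. Passing from m to m + 1 multiplies the distance of v
  by 3 and adds (3^m / H) / 2 to the covering bound, whence the geometric sum (3^m - 1) / (4 *
  H).\<close>

lemma reach_lattice:
  assumes "W \<subseteq> L" "dim (span L) = dim (span W) + m"
  shows "(m > 0 \<longrightarrow> (\<exists>v\<in>L - span W. reach K (span W) (3 ^ (m - 1) / H) v)) \<and>
    (\<forall>x\<in>span L. \<exists>l\<in>L. reach K (span W) ((3 ^ m - 1) / (4 * H)) (x - l))"
  using assms
proof (induction m arbitrary: W)
  case 0
  then have "span W = span L"
    by (metis add_0_right dim_span order_refl span_mono subspace_dim_equal subspace_span)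
  then show ?case using zero_mem reach_0 by (metis diff_zero div_0 less_irrefl power_0 diff_self)
next
  case (Suc m)
  have ins: "insert v W \<subseteq> L" "dim (span L) = dim (span (insert v W)) + m"
    if "v \<in> L - span W" for v
    using that Suc.prems by (auto simp: dim_insert)
  have ex: "\<exists>v\<in>L - span W. reach K (span W) (3 ^ m / H) v"
  proof (cases m)
    case 0
    then show ?thesis using reach_hyperplane Suc.prems by simp
  next
    case (Suc m')
    have "\<exists>v\<in>L - span W. reach K (span W) (3 * (3 ^ m' / H)) v"
      using Suc.IH[OF ins] Suc.prems Suc H_pos by (intro reach_halving) auto
    then show ?thesis using Suc by simp
  qed
  moreover have "\<exists>l\<in>L. reach K (span W) ((3 ^ Suc m - 1) / (4 * H)) (x - l)" if x: "x \<in> span L" for x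
  proof -
    obtain v where v: "v \<in> L - span W" "reach K (span W) (3 ^ m / H) v" using ex by auto
    obtain l where l: "l \<in> L" "reach K (span (insert v W)) ((3 ^ m - 1) / (4 * H)) (x - l)"
      using Suc.IH[OF ins[OF v(1)]] x by blast
    have "(3::real) ^ m \<ge> 1" by simp
    then obtain j :: int where
      j: "reach K (span W) ((3 ^ m - 1) / (4 * H) + (3 ^ m / H) / 2) (x - l - of_int j *\<^sub>R v)"
      using reach_insert[OF l(2) v(2)] H_pos by auto
    have "(3 ^ m - 1) / (4 * H) + (3 ^ m / H) / 2 = (3 ^ Suc m - 1) / (4 * H)"
      using H_pos by (simp add: field_simps)
    moreover have "l + of_int j *\<^sub>R v \<in> L" using l v by (intro add_mem scaleR_mem) auto
    ultimately show ?thesis using j by (metis diff_diff_add)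
  qed
  ultimately show ?case by simp
qed

text \<open>The case W = {} of \<open>reach_lattice\<close>: the span is the zero space, so being
  within distance 1 of it means lying in K.\<close>

lemma covering:
  assumes "x \<in> span L" "3 ^ dim L \<le> 4 * H + 1"
  obtains l k where "l \<in> L" "k \<in> K" "x = l + k"
proof -
  obtain l where l: "l \<in> L" "reach K (span {}) ((3 ^ dim L - 1) / (4 * H)) (x - l)"
    using reach_lattice[of "{}" "dim L"] assms(1) by auto
  have "(3::real) ^ dim L \<ge> 1" by simp
  then have "reach K (span {}) 1 (x - l)"
    using assms H_pos by (intro reach_mono[OF subspace_span l(2)]) auto
  then obtain k where "k \<in> K" "x - l = k" by (auto simp: reach_def)
  then show thesis using that l by (metis add.commute diff_add_cancel)
qed

end

section \<open>Rational subspaces\<close>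

definition int_vecs :: "(real ^ 'n) set" where
  "int_vecs = {k. \<forall>i. k $ i \<in> \<int>}"

interpretation int_vecs: integral_lattice "int_vecs :: (real ^ 'n) set"
  by unfold_locales (auto simp: int_vecs_def inner_vec_def)

lemma integral_lattice_int_vecs_Int: "subspace F \<Longrightarrow> integral_lattice (F \<inter> int_vecs)"
  by unfold_locales
    (auto simp: subspace_0 subspace_diff int_vecs.zero_mem int_vecs.diff_mem int_vecs.inner_Ints)

lemma common_denominator:
  fixes b :: "real ^ 'n"
  assumes "\<forall>i. b $ i \<in> \<rat>"
  obtains N :: int where "N > 0" "of_int N *\<^sub>R b \<in> int_vecs"
proof -
  have "\<exists>p q. q > (0::int) \<and> b $ i = of_int p / of_int q" for i
    using assms by (metis Rats_cases')
  then obtain p q where pq: "\<And>i. q i > (0::int)" "\<And>i. b $ i = of_int (p i) / of_int (q i)"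
    by metis
  define N where "N = prod q UNIV"
  have "N > 0" unfolding N_def using pq by (simp add: prod_pos)
  moreover have "of_int N * b $ i \<in> \<int>" for i
  proof -
    have "N = q i * prod q (UNIV - {i})" unfolding N_def by (simp add: prod.remove)
    then have "of_int N * b $ i = of_int (prod q (UNIV - {i}) * p i)"
      using pq(1)[of i] by (simp add: pq(2))
    then show ?thesis by (metis Ints_of_int)
  qed
  ultimately show thesis using that by (auto simp: int_vecs_def)
qed

text \<open>Denominators are cleared vector by vector. Independence is dropped so that sets produced
  by lattice operations can be used directly.\<close>

lemma rational_subspace_iff:
  fixes F :: "(real ^ 'n) set"
  shows "rational_subspace F \<longleftrightarrow> (\<exists>B. finite B \<and> B \<subseteq> int_vecs \<and> span B = F)"
proof
  assume "rational_subspace F"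
  then obtain B where B: "independent B" "span B = F" "\<forall>b\<in>B. \<forall>i. b $ i \<in> \<rat>"
    by (auto simp: rational_subspace_def)
  have "\<exists>N::int. N > 0 \<and> of_int N *\<^sub>R b \<in> int_vecs" if "b \<in> B" for b
    using common_denominator B(3) that by metis
  then obtain N :: "real ^ 'n \<Rightarrow> int" where
    N: "\<And>b. b \<in> B \<Longrightarrow> N b > 0 \<and> of_int (N b) *\<^sub>R b \<in> int_vecs"
    by metis
  have "span ((\<lambda>b. of_int (N b) *\<^sub>R b) ` B) = span B"
    using independent_imp_finite[OF B(1)] N by (intro span_image_scale) force+
  then show "\<exists>B. finite B \<and> B \<subseteq> int_vecs \<and> span B = F"
    using independent_imp_finite[OF B(1)] N B(2)
    by (intro exI[of _ "(\<lambda>b. of_int (N b) *\<^sub>R b) ` B"]) auto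
next
  assume "\<exists>B. finite B \<and> B \<subseteq> int_vecs \<and> span B = F"
  then obtain B where B: "B \<subseteq> int_vecs" "span B = F" by auto
  then obtain C where "C \<subseteq> B" "independent C" "span C = F"
    by (metis maximal_independent_subset span_mono span_span subset_antisym span_eq)
  moreover have "x \<in> \<rat>" if "x \<in> \<int>" for x :: real using that Ints_subset_Rats by auto
  ultimately show "rational_subspace F"
    using B(1) unfolding rational_subspace_def int_vecs_def by blast
qed

lemma rational_subspace_UNIV: "rational_subspace (UNIV :: (real ^ 'n) set)"
  unfolding rational_subspace_iff
proof (intro exI conjI)
  show "span Basis = (UNIV :: (real ^ 'n) set)" by (rule span_Basis)
qed (auto simp: int_vecs_def Basis_vec_def axis_def)

text \<open>An orthogonal integer basis C of F extends to an orthogonal integer spanning set D of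
  the whole space, and D - C spans the complement.\<close>

lemma rational_subspace_complement:
  fixes F :: "(real ^ 'n) set"
  assumes "rational_subspace F"
  shows "rational_subspace (orthogonal_comp F)"
proof -
  obtain B where B: "finite B" "B \<subseteq> int_vecs" "span B = F"
    using assms by (auto simp: rational_subspace_iff)
  obtain C where C: "finite C" "C \<subseteq> int_vecs" "0 \<notin> C" "pairwise orthogonal C" "span C = F"
    using int_vecs.orthogonal_extension_in[OF B(1,2), of "{}"] B(3) by auto
  obtain E :: "(real ^ 'n) set" where E: "finite E" "E \<subseteq> int_vecs" "span E = UNIV"
    using rational_subspace_UNIV by (auto simp: rational_subspace_iff)
  have CE: "span (C \<union> E) = UNIV" using E(3) span_mono[of E "C \<union> E"] by auto
  obtain D where D: "finite D" "C \<subseteq> D" "D \<subseteq> int_vecs" "pairwise orthogonal D" "span D = UNIV"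
    using int_vecs.orthogonal_extension_in[OF E(1,2) C(1-4)] unfolding CE by blast
  have "span (D - C) = orthogonal_comp F"
  proof (rule subset_antisym)
    show "orthogonal_comp F \<subseteq> span (D - C)"
    proof
      fix x assume "x \<in> orthogonal_comp F"
      then have "orthogonal x c" if "c \<in> C" for c
        using that C(5) by (auto simp: orthogonal_comp_def orthogonal_commute intro: span_base)
      then show "x \<in> span (D - C)"
        using orthogonal_span_split[OF D(4,2)] D(5) by auto
    qed
    have "D - C \<subseteq> orthogonal_comp F"
    proof
      fix x assume x: "x \<in> D - C"
      then have "orthogonal x c" if "c \<in> C" for c using D(2,4) that by (metis DiffE pairwiseD subsetD)
      then have "orthogonal x y" if "y \<in> span C" for y using orthogonal_to_span[OF that] by blast
      then show "x \<in> orthogonal_comp F"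
        unfolding C(5)[symmetric] orthogonal_comp_def by (simp add: orthogonal_commute)
    qed
    then show "span (D - C) \<subseteq> orthogonal_comp F"
      using subspace_orthogonal_comp by (rule span_minimal)
  qed
  then show ?thesis using D unfolding rational_subspace_iff by blast
qed

lemma subspace_rational: "rational_subspace F \<Longrightarrow> subspace F"
  by (auto simp: rational_subspace_def)

text \<open>By duality: the intersection is the orthogonal complement of the sum of the two
  complements, and sums are visibly rational.\<close>

lemma rational_subspace_Int:
  fixes F G :: "(real ^ 'n) set"
  assumes "rational_subspace F" "rational_subspace G"
  shows "rational_subspace (F \<inter> G)"
proof -
  obtain B C where B: "finite B" "B \<subseteq> int_vecs" "span B = orthogonal_comp F"
    and C: "finite C" "C \<subseteq> int_vecs" "span C = orthogonal_comp G"
    using assms rational_subspace_complement unfolding rational_subspace_iff by metis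
  have "orthogonal_comp (span (B \<union> C)) = F \<inter> G"
  proof -
    have 1: "x \<in> orthogonal_comp (span A) \<longleftrightarrow> (\<forall>a\<in>A. orthogonal a x)" for x and A :: "(real ^ 'n) set"
      by (auto simp: orthogonal_comp_def intro: span_base)
        (metis orthogonal_commute orthogonal_to_span)
    have "orthogonal_comp (span B) = F" "orthogonal_comp (span C) = G"
      using assms[THEN subspace_rational] by (simp_all add: B C orthogonal_comp_self)
    moreover have "orthogonal_comp (span (B \<union> C)) = orthogonal_comp (span B) \<inter> orthogonal_comp (span C)"
      by (rule set_eqI) (simp add: 1 ball_Un)
    ultimately show ?thesis by simp
  qed
  moreover have "rational_subspace (span (B \<union> C))"
    unfolding rational_subspace_iff using B C by (intro exI[of _ "B \<union> C"]) auto
  ultimately show ?thesis using rational_subspace_complement by metis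
qed

text \<open>The hull is an intersection of possibly infinitely many subspaces. A rational F of least
  dimension containing \<alpha> reduces this to two at a time: F \<inter> G cannot have smaller
  dimension, so F lies in every competitor G.\<close>

lemma rational_subspace_rat_hull:
  fixes \<alpha> :: "real ^ 'n"
  shows "rational_subspace (rat_hull \<alpha>)"
proof -
  define P where "P = (\<lambda>m. \<exists>F. rational_subspace F \<and> \<alpha> \<in> F \<and> dim F = m)"
  define d where "d = (LEAST m. P m)"
  have "P (dim (UNIV :: (real ^ 'n) set))"
    unfolding P_def using rational_subspace_UNIV by blast
  then have "P d" unfolding d_def by (rule LeastI)
  then obtain F where F: "rational_subspace F" "\<alpha> \<in> F" "dim F = d" by (auto simp: P_def)
  have "rat_hull \<alpha> = F"
    unfolding rat_hull_def
  proof (rule hull_unique)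
    fix G assume G: "{\<alpha>} \<subseteq> G" "rational_subspace G"
    have "rational_subspace (F \<inter> G)" using F G rational_subspace_Int by blast
    then have "P (dim (F \<inter> G))" unfolding P_def using F G by auto
    then have "dim F \<le> dim (F \<inter> G)" unfolding F(3) d_def by (rule Least_le)
    then have "F \<inter> G = F"
      using F G by (intro subspace_dim_equal subspace_inter subspace_rational) auto
    then show "F \<subseteq> G" by auto
  qed (use F in auto)
  with F show ?thesis by simp
qed

lemma subspace_rat_hull: "subspace (rat_hull \<alpha>)"
  using rational_subspace_rat_hull by (rule subspace_rational)

lemma mem_rat_hull: "\<alpha> \<in> rat_hull \<alpha>"
  unfolding rat_hull_def by (simp add: hull_inc)

lemma rat_lattice_eq: "rat_lattice \<alpha> = rat_hull \<alpha> \<inter> int_vecs"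
  by (simp add: rat_lattice_def int_vecs_def)

lemma integral_lattice_rat_lattice: "integral_lattice (rat_lattice \<alpha>)"
  unfolding rat_lattice_eq by (intro integral_lattice_int_vecs_Int subspace_rat_hull)

lemma span_rat_lattice: "span (rat_lattice \<alpha>) = rat_hull \<alpha>"
proof
  show "span (rat_lattice \<alpha>) \<subseteq> rat_hull \<alpha>"
    by (intro span_minimal subspace_rat_hull) (auto simp: rat_lattice_eq)
  obtain B where B: "B \<subseteq> int_vecs" "span B = rat_hull \<alpha>"
    using rational_subspace_rat_hull[of \<alpha>] by (auto simp: rational_subspace_iff)
  then have "B \<subseteq> rat_lattice \<alpha>" by (auto simp: rat_lattice_eq intro: span_base)
  then show "rat_hull \<alpha> \<subseteq> span (rat_lattice \<alpha>)" using span_mono B(2) by metis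
qed

text \<open>Otherwise the part of the hull orthogonal to \<open>k\<close> would be a smaller rational subspace
  containing \<open>\<alpha>\<close>.\<close>

lemma inner_rat_lattice_nonzero:
  assumes k: "k \<in> rat_lattice \<alpha>" "k \<noteq> 0"
  shows "k \<bullet> \<alpha> \<noteq> 0"
proof
  assume k\<alpha>: "k \<bullet> \<alpha> = 0"
  have kF: "k \<in> rat_hull \<alpha>" "k \<in> int_vecs" using k by (auto simp: rat_lattice_eq)
  obtain B where B: "finite B" "B \<subseteq> int_vecs" "span B = rat_hull \<alpha>"
    using rational_subspace_rat_hull[of \<alpha>] by (auto simp: rational_subspace_iff)
  obtain D where D: "finite D" "k \<in> D" "D \<subseteq> int_vecs" "pairwise orthogonal D"
    "span D = span ({k} \<union> B)"
    using int_vecs.orthogonal_extension_in[OF B(1,2), of "{k}"] kF k by (auto simp: pairwise_def)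
  have "span D = rat_hull \<alpha>" using D(5) B(3) kF(1) by (simp add: span_redundant)
  then have "\<alpha> \<in> span (D - {k})"
    using k\<alpha> mem_rat_hull[of \<alpha>] D(2)
    by (intro orthogonal_span_split[OF D(4)]) (auto simp: orthogonal_def inner_commute)
  moreover have "rational_subspace (span (D - {k}))" unfolding rational_subspace_iff using D by blast
  ultimately have "rat_hull \<alpha> \<subseteq> span (D - {k})" unfolding rat_hull_def by (simp add: hull_minimal)
  then have "k \<in> span (D - {k})" using kF by auto
  moreover have "orthogonal k x" if "x \<in> D - {k}" for x using that D by (metis DiffE pairwiseD singletonI)
  ultimately have "orthogonal k k" using orthogonal_to_span by blast
  then show False using k by (simp add: orthogonal_def)
qed

section \<open>Frames adapted to a lattice\<close>

lemma det_Ints: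
  fixes A :: "real ^ 'm ^ 'm"
  assumes "\<And>i j. A $ i $ j \<in> \<int>"
  shows "det A \<in> \<int>"
  unfolding det_def using assms by (intro Ints_sum Ints_mult Ints_prod) auto

text \<open>The indices in \<open>S\<close> number an orthonormal basis of the span of \<open>L\<close>, the other indices one of
  its orthogonal complement. Completing a basis of \<open>L\<close> by the latter gives square matrices of
  full size, so that no index type of cardinality \<open>dim L\<close> is needed.\<close>

locale lattice_frame = integral_lattice L for L :: "'a::euclidean_space set" +
  fixes \<pi> :: "'m::finite \<Rightarrow> 'a" and S :: "'m set"
  assumes orthonormal: "\<pi> i \<bullet> \<pi> j = (if i = j then 1 else 0)"
    and dim_eq: "DIM('a) = CARD('m)"
    and span_S: "span (\<pi> ` S) = span L"
begin

lemma inj_\<pi>: "inj \<pi>"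
proof (rule injI)
  fix i j assume "\<pi> i = \<pi> j"
  then show "i = j" using orthonormal[of i j] orthonormal[of j j] by (auto split: if_splits)
qed

lemma independent_\<pi>: "independent (\<pi> ` A)"
proof (rule pairwise_orthogonal_independent)
  show "pairwise orthogonal (\<pi> ` A)"
    by (auto simp: pairwise_def orthogonal_def orthonormal)
  show "0 \<notin> \<pi> ` A"
  proof
    assume "0 \<in> \<pi> ` A"
    then obtain i where "\<pi> i = 0" by auto
    then show False using orthonormal[of i i] by simp
  qed
qed

lemma span_\<pi>: "span (range \<pi>) = UNIV"
proof -
  have "independent (range \<pi>)" by (rule independent_\<pi>)
  moreover have "card (range \<pi>) = DIM('a)" using inj_\<pi> dim_eq by (simp add: card_image)
  ultimately show ?thesis
    using card_eq_dim[of "range \<pi>" UNIV] by (auto simp: independent_imp_finite)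
qed

lemma expand: "x = (\<Sum>i\<in>UNIV. (x \<bullet> \<pi> i) *\<^sub>R \<pi> i)"
proof -
  define y where "y = x - (\<Sum>i\<in>UNIV. (x \<bullet> \<pi> i) *\<^sub>R \<pi> i)"
  have "orthogonal y (\<pi> j)" for j
    by (simp add: y_def orthogonal_def inner_diff_left inner_sum_left orthonormal if_distrib cong: if_cong)
  then have "orthogonal y y" using orthogonal_to_span[of y "range \<pi>" y] span_\<pi> by auto
  then show ?thesis by (simp add: y_def orthogonal_def)
qed

lemma inner_expand: "x \<bullet> y = (\<Sum>i\<in>UNIV. (x \<bullet> \<pi> i) * (y \<bullet> \<pi> i))"
proof -
  have "x \<bullet> y = (\<Sum>i\<in>UNIV. (x \<bullet> \<pi> i) *\<^sub>R \<pi> i) \<bullet> y" by (simp only: expand[symmetric])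
  then show ?thesis by (simp add: inner_sum_left inner_commute[of "\<pi> _" y])
qed

lemma eq_iff: "x = y \<longleftrightarrow> (\<forall>i. x \<bullet> \<pi> i = y \<bullet> \<pi> i)"
proof
  assume eq: "\<forall>i. x \<bullet> \<pi> i = y \<bullet> \<pi> i"
  have "x = (\<Sum>i\<in>UNIV. (x \<bullet> \<pi> i) *\<^sub>R \<pi> i)" by (rule expand)
  also have "\<dots> = (\<Sum>i\<in>UNIV. (y \<bullet> \<pi> i) *\<^sub>R \<pi> i)" by (simp only: eq)
  also have "\<dots> = y" by (rule expand[symmetric])
  finally show "x = y" .
qed simp

lemma orthogonal_off_S:
  assumes "x \<in> span L" "i \<notin> S"
  shows "x \<bullet> \<pi> i = 0"
proof -
  have "orthogonal (\<pi> i) x"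
    using assms unfolding span_S[symmetric]
    by (intro orthogonal_to_span[of x "\<pi> ` S"]) (auto simp: orthogonal_def orthonormal)
  then show ?thesis by (simp add: orthogonal_def inner_commute)
qed

definition frame :: "('m \<Rightarrow> 'a) \<Rightarrow> bool" where
  "frame b \<longleftrightarrow> (\<forall>i\<in>S. b i \<in> L) \<and> (\<forall>i. i \<notin> S \<longrightarrow> b i = \<pi> i)"

definition frame_mat :: "('m \<Rightarrow> 'a) \<Rightarrow> real ^ 'm ^ 'm" where
  "frame_mat b = (\<chi> i j. b i \<bullet> \<pi> j)"

text \<open>For a frame, the vectors outside S are orthonormal and orthogonal to L, so the
  determinant of this matrix is the Gram determinant of the lattice vectors indexed by S
  alone.\<close>

definition gram :: "('m \<Rightarrow> 'a) \<Rightarrow> real ^ 'm ^ 'm" where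
  "gram b = (\<chi> i j. b i \<bullet> b j)"

lemma det_gram: "det (gram b) = (det (frame_mat b))\<^sup>2"
proof -
  have "gram b = frame_mat b ** transpose (frame_mat b)"
    unfolding gram_def frame_mat_def matrix_matrix_mult_def transpose_def
    by (auto simp: vec_eq_iff intro: inner_expand)
  then show ?thesis by (simp add: det_mul power2_eq_square)
qed

lemma frame_inner_Ints:
  assumes "frame b"
  shows "b i \<bullet> b j \<in> \<int>"
proof (cases "i \<in> S"; cases "j \<in> S")
  assume "i \<in> S" "j \<in> S"
  then show ?thesis using assms inner_Ints by (auto simp: frame_def)
next
  assume "i \<in> S" "j \<notin> S"
  then show ?thesis using assms orthogonal_off_S[of "b i" j] by (auto simp: frame_def span_base)
next
  assume "i \<notin> S" "j \<in> S"
  then show ?thesis using assms orthogonal_off_S[of "b j" i]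
    by (auto simp: frame_def span_base inner_commute)
next
  assume "i \<notin> S" "j \<notin> S"
  then show ?thesis using assms by (auto simp: frame_def orthonormal)
qed

lemma det_gram_Ints: "frame b \<Longrightarrow> det (gram b) \<in> \<int>"
  by (intro det_Ints) (simp add: gram_def frame_inner_Ints)

lemma frame_expand:
  assumes "det (frame_mat b) \<noteq> 0"
  shows "\<exists>!c :: real ^ 'm. x = (\<Sum>i\<in>UNIV. c $ i *\<^sub>R b i)"
proof -
  define M where "M = transpose (frame_mat b)"
  have iff: "x = (\<Sum>i\<in>UNIV. c $ i *\<^sub>R b i) \<longleftrightarrow> M *v c = (\<chi> j. x \<bullet> \<pi> j)" for c :: "real ^ 'm"
    unfolding eq_iff[of x]
    by (auto simp: vec_eq_iff M_def transpose_def frame_mat_def matrix_vector_mult_def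
        inner_sum_left mult.commute)
  have "invertible M" unfolding M_def using assms by (simp add: invertible_det_nz)
  then have "bij ((*v) M)" by (simp add: invertible_eq_bij)
  then show ?thesis unfolding iff by (metis bij_pointE)
qed

lemma frame_coord_off_S:
  assumes "frame b" "x \<in> span L" "x = (\<Sum>i\<in>UNIV. c i *\<^sub>R b i)" "j \<notin> S"
  shows "c j = 0"
proof -
  have eq: "c i * (b i \<bullet> \<pi> j) = (if i = j then c j else 0)" for i
  proof (cases "i \<in> S")
    case True
    then have "b i \<in> span L" using assms(1) by (auto simp: frame_def span_base)
    then have "b i \<bullet> \<pi> j = 0" using assms(4) by (rule orthogonal_off_S)
    then show ?thesis using True assms(4) by auto
  next
    case False
    then have "b i = \<pi> i" using assms(1) by (simp add: frame_def)
    then show ?thesis by (simp add: orthonormal)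
  qed
  have "0 = (\<Sum>i\<in>UNIV. c i *\<^sub>R b i) \<bullet> \<pi> j" using orthogonal_off_S[OF assms(2,4)] assms(3) by simp
  also have "\<dots> = (\<Sum>i\<in>UNIV. c i * (b i \<bullet> \<pi> j))" by (simp add: inner_sum_left)
  also have "\<dots> = (\<Sum>i\<in>UNIV. if i = j then c j else 0)" by (simp only: eq)
  finally show ?thesis by simp
qed

text \<open>The lattice vectors are a real basis of the span chosen inside L, numbered by S. They
  need not generate L over the integers.\<close>

lemma ex_frame: "\<exists>b. frame b \<and> det (frame_mat b) \<noteq> 0"
proof -
  obtain B where B: "B \<subseteq> L" "independent B" "L \<subseteq> span B" "card B = dim L"
    by (metis basis_exists)
  have spB: "span B = span L" using B by (metis span_mono span_minimal subspace_span subset_antisym)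
  have "independent (\<pi> ` S)" by (rule independent_\<pi>)
  then have "card (\<pi> ` S) = dim L" using span_S by (metis dim_span_eq_card_independent dim_span)
  then have "card S = card B" using B inj_\<pi> by (metis card_image inj_on_subset subset_UNIV)
  then obtain h where h: "bij_betw h S B"
    using B(2) by (meson finite finite_same_card_bij independent_imp_finite)
  define b where "b i = (if i \<in> S then h i else \<pi> i)" for i
  have fr: "frame b" using h B(1) by (auto simp: frame_def b_def bij_betw_def)
  have "c i = 0" if c: "(\<Sum>i\<in>UNIV. c i *s row i (frame_mat b)) = 0" for c i
  proof -
    have "(\<Sum>i\<in>UNIV. c i *s row i (frame_mat b)) $ j = (\<Sum>i\<in>UNIV. c i *\<^sub>R b i) \<bullet> \<pi> j" for j
      by (simp add: row_def frame_mat_def inner_sum_left)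
    then have 0: "0 = (\<Sum>i\<in>UNIV. c i *\<^sub>R b i)" using c eq_iff[of 0] by simp
    have off: "c j = 0" if "j \<notin> S" for j
      using frame_coord_off_S[OF fr span_zero 0 that] .
    have "0 = (\<Sum>i\<in>S. c i *\<^sub>R b i)"
      using off by (subst 0, intro sum.mono_neutral_right) auto
    also have "\<dots> = (\<Sum>i\<in>S. c (inv_into S h (h i)) *\<^sub>R h i)"
      using h by (intro sum.cong) (auto simp: b_def bij_betw_def)
    also have "\<dots> = (\<Sum>v\<in>B. c (inv_into S h v) *\<^sub>R v)"
      by (rule sum.reindex_bij_betw[OF h])
    finally have sum0: "(\<Sum>v\<in>B. c (inv_into S h v) *\<^sub>R v) = 0" by simp
    have "c (inv_into S h v) = 0" if "v \<in> B" for v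
      using independentD[OF B(2) independent_imp_finite[OF B(2)] order_refl sum0 that] .
    then have "c i = 0" if "i \<in> S" for i
      using that h bij_betw_apply[OF h that] bij_betw_inv_into_left[OF h that] by metis
    with off show ?thesis by blast
  qed
  then have "\<exists>M. frame_mat b ** M = mat 1"
    using matrix_right_invertible_independent_rows[of "frame_mat b"] by blast
  then have "det (frame_mat b) \<noteq> 0" using invertible_det_nz invertible_right_inverse by blast
  with fr show ?thesis by blast
qed

text \<open>Lattice vectors of minimal Gram determinant form a basis: a lattice vector with a coordinate
  \<open>c k\<close> outside \<open>\<int>\<close>, reduced modulo the frame and put in the place of \<open>b k\<close>,
  would multiply the determinant by the fractional part of \<open>c k\<close>.\<close>

lemma ex_lattice_basis:
  obtains b where "frame b" "det (frame_mat b) \<noteq> 0"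
    "\<And>v c i. v \<in> L \<Longrightarrow> v = (\<Sum>i\<in>UNIV. c i *\<^sub>R b i) \<Longrightarrow> c i \<in> \<int>"
proof -
  define P where "P n b \<longleftrightarrow> frame b \<and> det (frame_mat b) \<noteq> 0 \<and> det (gram b) = real n" for n b
  have natP: "\<exists>n. P n b" if fr: "frame b" "det (frame_mat b) \<noteq> 0" for b
  proof -
    obtain m where m: "det (gram b) = of_int m" using det_gram_Ints[OF fr(1)] by (auto elim: Ints_cases)
    then have "m \<ge> 0" by (metis det_gram of_int_0_le_iff zero_le_power2)
    then have "det (gram b) = real (nat m)" using m by simp
    then show ?thesis using fr unfolding P_def by blast
  qed
  define N where "N = (LEAST n. \<exists>b. P n b)"
  have "\<exists>b. P N b" unfolding N_def by (rule LeastI_ex) (use ex_frame natP in blast)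
  then obtain b where b: "frame b" "det (frame_mat b) \<noteq> 0" "det (gram b) = real N" by (auto simp: P_def)
  have min: "real N \<le> det (gram b')" if fr: "frame b'" "det (frame_mat b') \<noteq> 0" for b'
  proof -
    obtain n where "P n b'" using natP[OF fr] by blast
    moreover from this have "N \<le> n" unfolding N_def by (blast intro: Least_le)
    ultimately show ?thesis by (simp add: P_def)
  qed
  have key: "c k \<in> \<int>" if v: "v \<in> L" "v = (\<Sum>i\<in>UNIV. c i *\<^sub>R b i)" for v c k
  proof (rule ccontr)
    assume k: "c k \<notin> \<int>"
    have off: "c i = 0" if "i \<notin> S" for i
      using frame_coord_off_S[OF b(1) span_base[OF v(1)] v(2) that] .
    with k have kS: "k \<in> S" by (metis Ints_0)
    \<comment> \<open>v' is v with its coordinates reduced modulo 1. Coordinates outside S vanish,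
      so the part removed is an integer combination of lattice vectors only.\<close>
    define v' where "v' = (\<Sum>i\<in>UNIV. frac (c i) *\<^sub>R b i)"
    have "v' = v - (\<Sum>i\<in>UNIV. of_int \<lfloor>c i\<rfloor> *\<^sub>R b i)"
      unfolding v'_def v(2) by (simp add: frac_def scaleR_diff_left sum_subtractf)
    also have "(\<Sum>i\<in>UNIV. of_int \<lfloor>c i\<rfloor> *\<^sub>R b i) = (\<Sum>i\<in>S. of_int \<lfloor>c i\<rfloor> *\<^sub>R b i)"
      using off by (intro sum.mono_neutral_right) auto
    finally have v': "v' \<in> L" using v(1) b(1)
      by (auto simp: frame_def intro!: diff_mem sum_mem scaleR_mem)
    define b' where "b' = b(k := v')"
    have fr: "frame b'" using b(1) v' kS by (auto simp: frame_def b'_def)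
    \<comment> \<open>Row k becomes a combination of the old rows, the form in which the transposed
      Cramer rule reads off the factor \<open>frac (c k)\<close>.\<close>
    have "frame_mat b' = (\<chi> i. if i = k then \<Sum>i\<in>UNIV. (\<chi> i. frac (c i)) $ i *s row i (frame_mat b)
        else row i (frame_mat b))"
      by (simp add: vec_eq_iff frame_mat_def b'_def row_def v'_def inner_sum_left)
    then have det: "det (frame_mat b') = frac (c k) * det (frame_mat b)"
      using cramer_lemma_transpose[where k = k and A = "frame_mat b" and x = "\<chi> i. frac (c i)"] by simp
    have fk: "0 < frac (c k)" "frac (c k) < 1" using k by (auto simp: frac_gt_0_iff frac_lt_1)
    then have "det (frame_mat b') \<noteq> 0" using det b(2) by simp
    then have "real N \<le> det (gram b')" using min fr by blast
    also have "\<dots> = (frac (c k))\<^sup>2 * real N"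
      using b(3) by (simp add: det_gram det power_mult_distrib)
    also have "\<dots> < 1 * real N"
    proof (rule mult_strict_right_mono)
      show "0 < real N" using b(2,3) by (metis det_gram zero_less_power2)
      show "(frac (c k))\<^sup>2 < 1" using fk by (simp add: power_less_one_iff)
    qed
    finally show False by simp
  qed
  show thesis by (rule that[OF b(1,2)]) (rule key)
qed

text \<open>The coordinates of y solve a linear system with matrix \<open>gram b\<close> and right
  side y . b i, all entries being integers. By Cramer's rule the determinant times each coordinate
  is the determinant of an integer matrix.\<close>

lemma det_gram_scaleR_dual:
  assumes b: "frame b" "det (frame_mat b) \<noteq> 0"
    and y: "y \<in> span L" "\<And>l. l \<in> L \<Longrightarrow> y \<bullet> l \<in> \<int>"
  shows "det (gram b) *\<^sub>R y \<in> L"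
proof -
  obtain c :: "real ^ 'm" where c: "y = (\<Sum>i\<in>UNIV. c $ i *\<^sub>R b i)"
    using frame_expand[OF b(2)] by blast
  have off: "c $ i = 0" if "i \<notin> S" for i
    using frame_coord_off_S[OF b(1) y(1) c that] .
  have yb: "y \<bullet> b i \<in> \<int>" for i
    using b(1) y orthogonal_off_S[OF y(1), of i] by (cases "i \<in> S") (auto simp: frame_def)
  have "c $ k * det (gram b) \<in> \<int>" for k
  proof -
    have "(gram b *v c) $ i = y \<bullet> b i" for i
      by (subst c) (simp add: gram_def matrix_vector_mult_def inner_sum_left mult.commute inner_commute[of "b i"])
    then have "det (\<chi> i j. if j = k then (gram b *v c) $ i else gram b $ i $ j) \<in> \<int>"
      using yb frame_inner_Ints[OF b(1)] by (intro det_Ints) (auto simp: gram_def)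
    then show ?thesis by (simp only: cramer_lemma)
  qed
  then have Z: "det (gram b) * c $ k \<in> \<int>" for k by (simp add: mult.commute)
  have "det (gram b) *\<^sub>R y = (\<Sum>i\<in>UNIV. (det (gram b) * c $ i) *\<^sub>R b i)"
    by (subst c) (simp add: scaleR_sum_right)
  also have "\<dots> = (\<Sum>i\<in>S. (det (gram b) * c $ i) *\<^sub>R b i)"
    using off by (intro sum.mono_neutral_right) auto
  also have "\<dots> \<in> L" using Z b(1) by (intro sum_mem scaleR_mem) (auto simp: frame_def)
  finally show ?thesis .
qed

end

section \<open>The covolume\<close>

lemma emeasure_lborel_shift:
  fixes c :: "'a::euclidean_space"
  assumes "Y \<in> sets borel"
  shows "emeasure lborel {z. z - c \<in> Y} = emeasure lborel Y"
proof -
  have "emeasure lborel Y = emeasure (distr lborel borel ((+) (- c))) Y"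
    by (simp add: lborel_distr_plus)
  also have "\<dots> = emeasure lborel ((+) (- c) -` Y \<inter> space lborel)"
    using assms by (intro emeasure_distr) auto
  also have "(+) (- c) -` Y \<inter> space lborel = {z. z - c \<in> Y}" by auto
  finally show ?thesis by simp
qed

definition half_open_cube :: "(real ^ 'm) set" where
  "half_open_cube = {z. \<forall>i. 0 \<le> z $ i \<and> z $ i < 1}"

lemma half_open_cube_lmeasurable: "(half_open_cube :: (real ^ 'm) set) \<in> lmeasurable" (is ?A)
  and measure_half_open_cube: "measure lebesgue (half_open_cube :: (real ^ 'm) set) = 1" (is ?B)
proof -
  let ?c = "half_open_cube :: (real ^ 'm) set"
  have borel: "?c \<in> sets borel" unfolding half_open_cube_def by measurable
  have sub: "box 0 (\<chi> i. 1) \<subseteq> ?c" "?c \<subseteq> cbox 0 (\<chi> i. 1)"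
    by (auto simp: half_open_cube_def mem_box_cart less_imp_le)
  have prod: "(\<Prod>b\<in>Basis. ((\<chi> i. 1) - (0 :: real ^ 'm)) \<bullet> b) = 1"
    by (rule prod.neutral) (auto simp: Basis_vec_def inner_axis)
  have le: "(0 :: real ^ 'm) \<bullet> b \<le> (\<chi> i. 1) \<bullet> b" if "b \<in> Basis" for b
    using that by (auto simp: Basis_vec_def inner_axis)
  have "emeasure lborel (box 0 ((\<chi> i. 1) :: real ^ 'm)) = 1"
    using prod le by simp
  moreover have "emeasure lborel (cbox 0 ((\<chi> i. 1) :: real ^ 'm)) = 1"
    using prod le by (subst emeasure_lborel_cbox) auto
  ultimately have "emeasure lborel ?c = 1"
    using emeasure_mono[OF sub(1), of lborel] emeasure_mono[OF sub(2), of lborel] borel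
    by (intro antisym) auto
  then have "emeasure lebesgue ?c = 1" using borel by simp
  then show ?A ?B
    using borel by (auto simp: fmeasurable_def measure_def)
qed

text \<open>\<open>S_eq\<close> ties the frame to the very basis selected inside
  \<open>subspace_lborel\<close>, which avoids an appeal to rotation invariance.\<close>

locale volume_frame = lattice_frame L \<pi> S for L :: "'a::euclidean_space set"
    and \<pi> :: "'m::finite \<Rightarrow> 'a" and S :: "'m set" +
  assumes S_eq: "\<pi> ` S = (SOME E. orthonormal_basis_of (span L) E)"
begin

interpretation P: product_sigma_finite "\<lambda>_::'a. lborel :: real measure"
  by standard

lemma subspace_lborel_eq:
  "subspace_lborel (span L) = distr (\<Pi>\<^sub>M e\<in>\<pi> ` S. (lborel :: real measure)) borel
     (\<lambda>f. \<Sum>i\<in>S. f (\<pi> i) *\<^sub>R \<pi> i)"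
  unfolding subspace_lborel_def S_eq[symmetric] Let_def
  using inj_\<pi> by (subst sum.reindex) (auto simp: inj_on_def inj_def)

lemma coords_measurable:
  "(\<lambda>f. (\<chi> i. f (\<pi> i)) :: real ^ 'm) \<in>
    measurable (\<Pi>\<^sub>M e\<in>range \<pi>. (lborel :: real measure)) borel"
proof (rule borel_measurable_euclidean_space[THEN iffD2, rule_format])
  fix b :: "real ^ 'm" assume "b \<in> Basis"
  then obtain j where b: "b = axis j 1" by (auto simp: Basis_vec_def)
  have "(\<lambda>f. f (\<pi> j)) \<in> measurable (\<Pi>\<^sub>M e\<in>range \<pi>. (lborel :: real measure)) lborel"
    by (rule measurable_component_singleton) simp
  then show "(\<lambda>f. (\<chi> i. f (\<pi> i)) \<bullet> b) \<in>
      borel_measurable (\<Pi>\<^sub>M e\<in>range \<pi>. (lborel :: real measure))"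
    by (simp add: b inner_axis)
qed

lemma distr_coords:
  "distr (\<Pi>\<^sub>M e\<in>range \<pi>. (lborel :: real measure)) borel (\<lambda>f. \<chi> i. f (\<pi> i)) =
    (lborel :: (real ^ 'm) measure)" (is "?D = _")
proof (rule lborel_eqI[symmetric])
  fix l u :: "real ^ 'm"
  assume lu: "\<And>b. b \<in> Basis \<Longrightarrow> l \<bullet> b \<le> u \<bullet> b"
  have le: "l $ i \<le> u $ i" for i
    using lu[of "axis i 1"] by (simp add: inner_axis axis_in_Basis_iff)
  define \<iota> where "\<iota> = inv \<pi>"
  have \<iota>: "\<iota> (\<pi> i) = i" for i using inj_\<pi> by (simp add: \<iota>_def)
  have pre: "(\<lambda>f. \<chi> i. f (\<pi> i)) -` box l u \<inter> space (\<Pi>\<^sub>M e\<in>range \<pi>. (lborel :: real measure))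
      = (\<Pi>\<^sub>E e\<in>range \<pi>. {l $ \<iota> e<..<u $ \<iota> e})"
    by (auto simp: space_PiM mem_box_cart PiE_def Pi_iff \<iota>)
  have "emeasure ?D (box l u) = (\<Prod>e\<in>range \<pi>. emeasure lborel {l $ \<iota> e<..<u $ \<iota> e})"
    by (subst emeasure_distr[OF coords_measurable]) (auto simp: pre intro!: P.emeasure_PiM)
  also have "\<dots> = (\<Prod>i\<in>UNIV. ennreal (u $ i - l $ i))"
    using inj_\<pi> le by (subst prod.reindex) (auto simp: \<iota>)
  also have "\<dots> = ennreal (\<Prod>i\<in>UNIV. u $ i - l $ i)"
    using le by (intro prod_ennreal) auto
  also have "(\<Prod>i\<in>UNIV. u $ i - l $ i) = (\<Prod>b\<in>Basis. (u - l) \<bullet> b)"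
    by (simp add: Basis_vec_def cart_eq_inner_axis axis_eq_axis prod.UNION_disjoint inner_diff_left)
  finally show "emeasure ?D (box l u) = ennreal (\<Prod>b\<in>Basis. (u - l) \<bullet> b)" .
qed simp

text \<open>Multiplying by a unit cube in the orthogonal complement reduces volumes in the span of \<open>L\<close>
  to Lebesgue measure in the coordinates given by \<open>\<pi>\<close>.\<close>

definition thicken :: "'a set \<Rightarrow> (real ^ 'm) set" where
  "thicken X = {z. (\<Sum>i\<in>S. z $ i *\<^sub>R \<pi> i) \<in> X \<and> (\<forall>i. i \<notin> S \<longrightarrow> 0 \<le> z $ i \<and> z $ i < 1)}"

lemma thicken_borel [measurable]:
  assumes [measurable]: "X \<in> sets borel"
  shows "thicken X \<in> sets borel"
  unfolding thicken_def by measurable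

text \<open>The product measure over all of \<open>range \<pi>\<close> splits into the factors from
  S and the others. The thickened set is a product A \<times> B in these coordinates, and the unit
  cube B has measure 1.\<close>

lemma emeasure_subspace_lborel:
  assumes X: "X \<in> sets borel"
  shows "emeasure (subspace_lborel (span L)) X = emeasure lborel (thicken X)"
proof -
  let ?M = "\<lambda>I::'a set. \<Pi>\<^sub>M e\<in>I. (lborel :: real measure)"
  define I I' where "I = \<pi> ` S" and "I' = \<pi> ` (- S)"
  have II': "I \<inter> I' = {}" "finite I" "finite I'" "range \<pi> = I \<union> I'"
    using inj_\<pi> by (auto simp: I_def I'_def inj_def)
  define A where "A = (\<lambda>f. \<Sum>i\<in>S. f (\<pi> i) *\<^sub>R \<pi> i) -` X \<inter> space (?M I)"
  define B where "B = (\<Pi>\<^sub>E e\<in>I'. {0..<1::real})"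
  define C where "C = (\<lambda>f. (\<chi> i. f (\<pi> i)) :: real ^ 'm) -` thicken X \<inter> space (?M (I \<union> I'))"
  have sum_meas: "(\<lambda>f. \<Sum>i\<in>S. f (\<pi> i) *\<^sub>R \<pi> i) \<in> measurable (?M I) borel"
    by (intro borel_measurable_sum borel_measurable_scaleR measurable_component_singleton[THEN measurable_compose])
      (auto simp: I_def)
  have chi_meas: "(\<lambda>f. (\<chi> i. f (\<pi> i)) :: real ^ 'm) \<in> measurable (?M (I \<union> I')) borel"
    using coords_measurable by (simp only: II'(4))
  have A: "A \<in> sets (?M I)" unfolding A_def using sum_meas X by (rule measurable_sets)
  have B: "B \<in> sets (?M I')" unfolding B_def using II' by (intro sets_PiM_I_finite) auto
  have C: "C \<in> sets (?M (I \<union> I'))"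
    unfolding C_def using chi_meas thicken_borel[OF X] by (rule measurable_sets)
  interpret M': sigma_finite_measure "?M I'"
    by (rule P.sigma_finite) (rule II')
  have AB: "merge I I' -` C \<inter> space (?M I \<Otimes>\<^sub>M ?M I') = A \<times> B"
  proof -
    have "merge I I' (f, g) \<in> C \<longleftrightarrow> f \<in> A \<and> g \<in> B"
      if f: "f \<in> space (?M I)" and g: "g \<in> space (?M I')" for f g
    proof -
      have mS: "merge I I' (f, g) (\<pi> i) = f (\<pi> i)" if "i \<in> S" for i
        using that by (simp add: merge_def I_def)
      have mS': "merge I I' (f, g) (\<pi> i) = g (\<pi> i)" if "i \<notin> S" for i
        using that II'(1) by (auto simp: merge_def I_def I'_def)
      have sp: "merge I I' (f, g) \<in> space (?M (I \<union> I'))"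
        using f g by (auto simp: space_PiM PiE_def merge_def extensional_def)
      have "(\<Sum>i\<in>S. merge I I' (f, g) (\<pi> i) *\<^sub>R \<pi> i) = (\<Sum>i\<in>S. f (\<pi> i) *\<^sub>R \<pi> i)"
        by (intro sum.cong) (auto simp: mS)
      moreover have "(\<forall>i. i \<notin> S \<longrightarrow> 0 \<le> g (\<pi> i) \<and> g (\<pi> i) < 1) \<longleftrightarrow> g \<in> B"
        using g by (auto simp: B_def I'_def space_PiM PiE_def Pi_iff)
      ultimately show ?thesis
        using sp f by (auto simp: C_def A_def thicken_def mS')
    qed
    moreover have "B \<subseteq> space (?M I')" "A \<subseteq> space (?M I)" using A B sets.sets_into_space by auto
    ultimately show ?thesis by (auto simp: space_pair_measure subset_iff)
  qed
  have "emeasure lborel (thicken X) = emeasure (?M (I \<union> I')) C"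
    unfolding C_def II'(4)[symmetric]
    by (subst distr_coords[symmetric], rule emeasure_distr[OF coords_measurable thicken_borel[OF X]])
  also have "\<dots> = emeasure (distr (?M I \<Otimes>\<^sub>M ?M I') (?M (I \<union> I')) (merge I I')) C"
    by (simp only: P.distr_merge[OF II'(1-3)])
  also have "\<dots> = emeasure (?M I \<Otimes>\<^sub>M ?M I') (A \<times> B)"
    unfolding AB[symmetric] using measurable_merge C by (rule emeasure_distr)
  also have "\<dots> = emeasure (?M I) A * emeasure (?M I') B"
    using A B by (rule M'.emeasure_pair_measure_Times)
  also have "emeasure (?M I') B = 1"
    unfolding B_def using II' by (subst P.emeasure_PiM) auto
  also have "emeasure (?M I) A = emeasure (subspace_lborel (span L)) X"
    unfolding A_def subspace_lborel_eq I_def[symmetric]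
    using sum_meas X by (rule emeasure_distr[symmetric])
  finally show ?thesis by simp
qed

lemma sets_subspace_lborel: "sets (subspace_lborel (span L)) = sets borel"
  by (simp add: subspace_lborel_eq)

text \<open>A vector of \<open>span L\<close> has zero coordinates outside S, so translation by it
  commutes with thickening and becomes a translation of Lebesgue measure.\<close>

lemma emeasure_subspace_lborel_shift:
  assumes X[measurable]: "X \<in> sets borel" and l: "l \<in> span L"
  shows "emeasure (subspace_lborel (span L)) {x. x - l \<in> X} = emeasure (subspace_lborel (span L)) X"
proof -
  define c :: "real ^ 'm" where "c = (\<chi> i. l \<bullet> \<pi> i)"
  have c0: "c $ i = 0" if "i \<notin> S" for i using orthogonal_off_S[OF l that] by (simp add: c_def)
  have "(\<Sum>i\<in>S. c $ i *\<^sub>R \<pi> i) = (\<Sum>i\<in>UNIV. c $ i *\<^sub>R \<pi> i)"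
    using c0 by (intro sum.mono_neutral_left) auto
  also have "\<dots> = l" by (simp add: c_def expand[symmetric])
  finally have "thicken {x. x - l \<in> X} = {z. z - c \<in> thicken X}"
    using c0 by (auto simp: thicken_def scaleR_diff_left sum_subtractf)
  moreover have "{x. x - l \<in> X} \<in> sets borel" by measurable
  ultimately show ?thesis by (simp add: emeasure_subspace_lborel emeasure_lborel_shift)
qed

text \<open>Cut D according to the lattice vector l that carries a point into D', and translate each
  piece by -l. The translated pieces lie in D', and they are disjoint because D contains only one
  representative of each class.\<close>

lemma emeasure_fundamental_domain_le:
  assumes L: "countable L" and D: "fundamental_domain (span L) L D"
    and D': "fundamental_domain (span L) L D'"
  shows "emeasure (subspace_lborel (span L)) D \<le> emeasure (subspace_lborel (span L)) D'"
proof -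
  let ?M = "subspace_lborel (span L)"
  have [measurable]: "D \<in> sets borel" "D' \<in> sets borel" using D D' by (auto simp: fundamental_domain_def)
  have uD: "l = l'" if "l \<in> L" "l' \<in> L" "x \<in> span L" "x - l \<in> D" "x - l' \<in> D" for l l' x
    using that D unfolding fundamental_domain_def by blast
  have uD': "l = l'" if "l \<in> L" "l' \<in> L" "x \<in> span L" "x - l \<in> D'" "x - l' \<in> D'" for l l' x
    using that D' unfolding fundamental_domain_def by blast
  have sub: "D \<subseteq> span L" "D' \<subseteq> span L" using D D' by (auto simp: fundamental_domain_def)
  have meas: "{x \<in> D. x - l \<in> D'} \<in> sets ?M" "{x \<in> D'. x - l \<in> D} \<in> sets ?M" for l
    unfolding sets_subspace_lborel by measurable
  have "D = (\<Union>l\<in>L. {x \<in> D. x - l \<in> D'})"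
    using D' sub unfolding fundamental_domain_def by blast
  then have "emeasure ?M D = emeasure ?M (\<Union>l\<in>L. {x \<in> D. x - l \<in> D'})" by simp
  also have "\<dots> = (\<integral>\<^sup>+l. emeasure ?M {x \<in> D. x - l \<in> D'} \<partial>count_space L)"
    using meas L sub uD' by (intro emeasure_UN_countable) (auto simp: disjoint_family_on_def)
  also have "\<dots> = (\<integral>\<^sup>+l. emeasure ?M {x \<in> D'. x - (- l) \<in> D} \<partial>count_space L)"
  proof (rule nn_integral_cong)
    fix l assume "l \<in> space (count_space L)"
    then have l: "l \<in> span L" by (simp add: span_base)
    have "{x. x - l \<in> {x \<in> D'. x - (- l) \<in> D}} = {x \<in> D. x - l \<in> D'}" by auto
    then show "emeasure ?M {x \<in> D. x - l \<in> D'} = emeasure ?M {x \<in> D'. x - (- l) \<in> D}"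
      using emeasure_subspace_lborel_shift[of "{x \<in> D'. x - (- l) \<in> D}" l] l meas(2)[of "- l"]
      by (simp add: sets_subspace_lborel)
  qed
  also have "\<dots> = emeasure ?M (\<Union>l\<in>L. {x \<in> D'. x - (- l) \<in> D})"
  proof (rule emeasure_UN_countable[symmetric])
    show "{x \<in> D'. x - (- l) \<in> D} \<in> sets ?M" for l by (rule meas)
    show "disjoint_family_on (\<lambda>l. {x \<in> D'. x - (- l) \<in> D}) L"
    proof (unfold disjoint_family_on_def, intro ballI impI)
      fix l l' assume l: "l \<in> L" "l' \<in> L" "l \<noteq> l'"
      then show "{x \<in> D'. x - (- l) \<in> D} \<inter> {x \<in> D'. x - (- l') \<in> D} = {}"
        using uD[OF minus_mem[OF l(1)] minus_mem[OF l(2)]] sub by auto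
    qed
  qed (rule L)
  also have "\<dots> \<le> emeasure ?M D'"
    by (intro emeasure_mono) (auto simp: sets_subspace_lborel)
  finally show ?thesis .
qed

text \<open>The coordinates run over the full index type, with zeros outside S, so that
  \<open>frame_expand\<close> applies to them.\<close>

definition parallelepiped :: "('m \<Rightarrow> 'a) \<Rightarrow> 'a set" where
  "parallelepiped b = {x. \<exists>c :: real ^ 'm. x = (\<Sum>i\<in>UNIV. c $ i *\<^sub>R b i) \<and>
     (\<forall>i. 0 \<le> c $ i \<and> c $ i < 1) \<and> (\<forall>i. i \<notin> S \<longrightarrow> c $ i = 0)}"

lemma parallelepiped_subset:
  assumes "frame b"
  shows "parallelepiped b \<subseteq> span L"
proof
  fix x assume "x \<in> parallelepiped b"
  then obtain c :: "real ^ 'm" where c: "x = (\<Sum>i\<in>UNIV. c $ i *\<^sub>R b i)" "\<And>i. i \<notin> S \<Longrightarrow> c $ i = 0"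
    by (auto simp: parallelepiped_def)
  have "c $ i *\<^sub>R b i \<in> span L" for i
    using assms c(2)[of i] by (cases "i \<in> S") (auto simp: frame_def span_base span_scale span_zero)
  then show "x \<in> span L" unfolding c(1) by (intro span_sum)
qed

text \<open>As the image of a Borel set under an invertible linear map, it is also a preimage under
  the inverse map, which is continuous.\<close>

lemma parallelepiped_borel:
  assumes "det (frame_mat b) \<noteq> 0"
  shows "parallelepiped b \<in> sets borel"
proof -
  define T :: "real ^ 'm \<Rightarrow> 'a" where "T c = (\<Sum>i\<in>UNIV. c $ i *\<^sub>R b i)" for c
  define Q :: "(real ^ 'm) set" where
    "Q = {c. (\<forall>i. 0 \<le> c $ i \<and> c $ i < 1) \<and> (\<forall>i. i \<notin> S \<longrightarrow> c $ i = 0)}"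
  have T: "linear T"
    by (auto simp: T_def linear_iff scaleR_add_left sum.distrib scaleR_sum_right)
  have ex1: "\<exists>!c. x = T c" for x unfolding T_def by (rule frame_expand[OF assms])
  then have "inj T" by (intro injI) metis
  then obtain g where g: "linear g" "g \<circ> T = id" using T linear_injective_left_inverse by blast
  have gT: "g (T c) = c" for c using g(2) by (metis comp_apply id_apply)
  have Tg: "T (g x) = x" for x using ex1[of x] gT by metis
  have "parallelepiped b = T ` Q" by (auto simp: parallelepiped_def Q_def T_def)
  also have "\<dots> = g -` Q" by (auto simp: gT) (metis Tg image_eqI)
  finally have "parallelepiped b = g -` Q \<inter> space borel" by simp
  moreover have "g \<in> borel_measurable borel"
    using g(1) by (intro borel_measurable_continuous_onI linear_continuous_on) (simp add: linear_conv_bounded_linear)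
  moreover have "Q \<in> sets borel" unfolding Q_def by measurable
  ultimately show ?thesis by (metis measurable_sets)
qed

text \<open>The representative takes the integer parts of the coordinates. For uniqueness,
  \<open>basis\<close> makes the coordinates c - e of any competing lattice vector integers, and 0
  <= e < 1 forces them to be those integer parts.\<close>

lemma fundamental_domain_parallelepiped:
  assumes b: "frame b" "det (frame_mat b) \<noteq> 0"
    and basis: "\<And>v c i. v \<in> L \<Longrightarrow> v = (\<Sum>i\<in>UNIV. c i *\<^sub>R b i) \<Longrightarrow> c i \<in> \<int>"
  shows "fundamental_domain (span L) L (parallelepiped b)"
  unfolding fundamental_domain_def
proof (intro conjI ballI)
  show "parallelepiped b \<in> sets borel" using b(2) by (rule parallelepiped_borel)
  show "parallelepiped b \<subseteq> span L" using b(1) by (rule parallelepiped_subset)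
  fix x assume x: "x \<in> span L"
  obtain c :: "real ^ 'm" where c: "x = (\<Sum>i\<in>UNIV. c $ i *\<^sub>R b i)"
    using frame_expand[OF b(2)] by blast
  have off: "c $ i = 0" if "i \<notin> S" for i using frame_coord_off_S[OF b(1) x c that] .
  define l where "l = (\<Sum>i\<in>UNIV. of_int \<lfloor>c $ i\<rfloor> *\<^sub>R b i)"
  show "\<exists>!l. l \<in> L \<and> x - l \<in> parallelepiped b"
  proof (rule ex1I[of _ l])
    have "l = (\<Sum>i\<in>S. of_int \<lfloor>c $ i\<rfloor> *\<^sub>R b i)"
      unfolding l_def using off by (intro sum.mono_neutral_right) auto
    then have lL: "l \<in> L" using b(1) by (auto simp: frame_def intro!: sum_mem scaleR_mem)
    have "x - l = (\<Sum>i\<in>UNIV. (\<chi> i. frac (c $ i)) $ i *\<^sub>R b i)"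
      by (simp add: c l_def frac_def scaleR_diff_left sum_subtractf)
    then have "x - l \<in> parallelepiped b"
      unfolding parallelepiped_def using off
      by (auto intro!: exI[of _ "\<chi> i. frac (c $ i)"] simp: frac_lt_1)
    with lL show "l \<in> L \<and> x - l \<in> parallelepiped b" ..
  next
    fix l' assume l': "l' \<in> L \<and> x - l' \<in> parallelepiped b"
    then obtain e :: "real ^ 'm" where e: "x - l' = (\<Sum>i\<in>UNIV. e $ i *\<^sub>R b i)"
      "\<And>i. 0 \<le> e $ i" "\<And>i. e $ i < 1" unfolding parallelepiped_def by blast
    have l'_eq: "l' = (\<Sum>i\<in>UNIV. (c $ i - e $ i) *\<^sub>R b i)"
      using e(1) c by (simp add: scaleR_diff_left sum_subtractf algebra_simps)
    have "c $ i - e $ i = of_int \<lfloor>c $ i\<rfloor>" for i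
    proof -
      obtain n where n: "c $ i - e $ i = of_int n"
        using basis[OF _ l'_eq, of i] l' by (auto elim: Ints_cases)
      then have "\<lfloor>c $ i\<rfloor> = n" using e(2,3)[of i] by (intro floor_unique) linarith+
      then show ?thesis using n by simp
    qed
    then show "l' = l" unfolding l'_eq l_def by simp
  qed
qed

lemma inner_sum_\<pi>: "(\<Sum>i\<in>UNIV. g i *\<^sub>R \<pi> i) \<bullet> \<pi> j = g j"
  by (simp add: inner_sum_left orthonormal if_distrib cong: if_cong)

text \<open>The unit cube added by \<open>thicken\<close> is spanned by the \<pi> i with i outside
  S, which are frame vectors themselves. So the thickened set is the full parallelepiped of the
  frame, a linear image of the unit cube.\<close>

lemma thicken_parallelepiped:
  assumes b: "frame b"
  shows "thicken (parallelepiped b) = (\<lambda>z. z v* frame_mat b) ` half_open_cube"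
proof -
  have tr: "(w v* frame_mat b) $ j = (\<Sum>i\<in>UNIV. w $ i *\<^sub>R b i) \<bullet> \<pi> j" for w :: "real ^ 'm" and j
    by (simp add: vector_matrix_mult_def frame_mat_def inner_sum_left mult.commute)
  have split: "(\<Sum>i\<in>UNIV. w i *\<^sub>R b i) =
      (\<Sum>i\<in>UNIV. (if i \<in> S then w i else 0) *\<^sub>R b i) + (\<Sum>i\<in>UNIV. (if i \<in> S then 0 else w i) *\<^sub>R \<pi> i)" for w
    unfolding sum.distrib[symmetric] using b by (intro sum.cong) (auto simp: frame_def)
  show ?thesis
  proof (intro set_eqI iffI)
    fix z assume "z \<in> thicken (parallelepiped b)"
    then obtain c :: "real ^ 'm" where z: "\<And>i. i \<notin> S \<Longrightarrow> 0 \<le> z $ i \<and> z $ i < 1"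
      and c: "(\<Sum>i\<in>S. z $ i *\<^sub>R \<pi> i) = (\<Sum>i\<in>UNIV. c $ i *\<^sub>R b i)"
        "\<And>i. 0 \<le> c $ i \<and> c $ i < 1" "\<And>i. i \<notin> S \<Longrightarrow> c $ i = 0"
      by (auto simp: thicken_def parallelepiped_def)
    define w :: "real ^ 'm" where "w = (\<chi> i. if i \<in> S then c $ i else z $ i)"
    have "(\<Sum>i\<in>UNIV. w $ i *\<^sub>R b i) =
        (\<Sum>i\<in>UNIV. c $ i *\<^sub>R b i) + (\<Sum>i\<in>UNIV. (if i \<in> S then 0 else z $ i) *\<^sub>R \<pi> i)"
      unfolding split[of "\<lambda>i. w $ i"] using c(3)
      by (intro arg_cong2[where f = "(+)"] sum.cong) (auto simp: w_def)
    also have "(\<Sum>i\<in>UNIV. c $ i *\<^sub>R b i) = (\<Sum>i\<in>UNIV. (if i \<in> S then z $ i else 0) *\<^sub>R \<pi> i)"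
      unfolding c(1)[symmetric] by (intro sum.mono_neutral_cong_left) auto
    also have "\<dots> + (\<Sum>i\<in>UNIV. (if i \<in> S then 0 else z $ i) *\<^sub>R \<pi> i) = (\<Sum>i\<in>UNIV. z $ i *\<^sub>R \<pi> i)"
      unfolding sum.distrib[symmetric] by (intro sum.cong) auto
    finally have "(w v* frame_mat b) $ j = z $ j" for j
      by (simp add: tr inner_sum_\<pi>)
    then have "z = w v* frame_mat b" by (simp add: vec_eq_iff)
    moreover have "w \<in> half_open_cube" using z c(2) by (auto simp: half_open_cube_def w_def)
    ultimately show "z \<in> (\<lambda>z. z v* frame_mat b) ` half_open_cube" by blast
  next
    fix z assume "z \<in> (\<lambda>z. z v* frame_mat b) ` half_open_cube"
    then obtain w :: "real ^ 'm" where w: "\<And>i. 0 \<le> w $ i \<and> w $ i < 1" "z = w v* frame_mat b"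
      by (auto simp: half_open_cube_def)
    define c :: "real ^ 'm" where "c = (\<chi> i. if i \<in> S then w $ i else 0)"
    define v where "v = (\<Sum>i\<in>UNIV. c $ i *\<^sub>R b i)"
    have "\<forall>i. 0 \<le> c $ i \<and> c $ i < 1" "\<forall>i. i \<notin> S \<longrightarrow> c $ i = 0" using w(1) by (auto simp: c_def)
    then have vP: "v \<in> parallelepiped b" unfolding parallelepiped_def v_def by blast
    then have vL: "v \<in> span L" using parallelepiped_subset[OF b] by auto
    have zj: "z $ j = v \<bullet> \<pi> j + (if j \<in> S then 0 else w $ j)" for j
      unfolding w(2) tr split[of "\<lambda>i. w $ i"] inner_add_left inner_sum_\<pi> by (simp add: v_def c_def)
    have "(\<Sum>i\<in>S. z $ i *\<^sub>R \<pi> i) = (\<Sum>i\<in>UNIV. (v \<bullet> \<pi> i) *\<^sub>R \<pi> i)"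
      using orthogonal_off_S[OF vL] by (intro sum.mono_neutral_cong_left) (auto simp: zj)
    also have "\<dots> = v" by (rule expand[symmetric])
    finally show "z \<in> thicken (parallelepiped b)"
      using vP w(1) orthogonal_off_S[OF vL] by (auto simp: thicken_def zj)
  qed
qed

end

text \<open>d is the Gram determinant of a lattice basis: one number that is both the squared
  covolume and a multiplier taking the dual lattice into L.\<close>

lemma covolume_sq:
  fixes \<pi> :: "'m::{finite,wellorder} \<Rightarrow> 'a::euclidean_space"
  assumes "volume_frame L \<pi> S" "countable L"
  obtains d where "d \<in> \<int>" "d > 0" "(covolume (span L) L)\<^sup>2 = d"
    "\<And>y. y \<in> span L \<Longrightarrow> (\<And>l. l \<in> L \<Longrightarrow> y \<bullet> l \<in> \<int>) \<Longrightarrow> d *\<^sub>R y \<in> L"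
proof -
  interpret volume_frame L \<pi> S by fact
  obtain b where b: "frame b" "det (frame_mat b) \<noteq> 0"
    "\<And>v c i. v \<in> L \<Longrightarrow> v = (\<Sum>i\<in>UNIV. c i *\<^sub>R b i) \<Longrightarrow> c i \<in> \<int>"
    using ex_lattice_basis by blast
  have fd: "fundamental_domain (span L) L (parallelepiped b)"
    using b by (rule fundamental_domain_parallelepiped)
  define D where "D = (SOME D. fundamental_domain (span L) L D)"
  have D: "fundamental_domain (span L) L D" unfolding D_def using fd by (rule someI)
  have "emeasure (subspace_lborel (span L)) D = emeasure (subspace_lborel (span L)) (parallelepiped b)"
    using fd D assms(2) by (intro antisym emeasure_fundamental_domain_le)
  also have "\<dots> = emeasure lborel (thicken (parallelepiped b))"
    using parallelepiped_borel[OF b(2)] by (rule emeasure_subspace_lborel)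
  also have "\<dots> = emeasure lebesgue (thicken (parallelepiped b))"
    using thicken_borel[OF parallelepiped_borel[OF b(2)]] by simp
  finally have "covolume (span L) L = measure lebesgue (thicken (parallelepiped b))"
    unfolding covolume_def D_def[symmetric] by (simp add: measure_def)
  also have "\<dots> = \<bar>det (frame_mat b)\<bar>"
    unfolding thicken_parallelepiped[OF b(1)]
    using measure_linear_image[OF matrix_vector_mul_linear[of "transpose (frame_mat b)"] half_open_cube_lmeasurable]
    by (simp add: measure_half_open_cube del: transpose_matrix_vector)
      (simp add: matrix_of_matrix_vector_mul[of "transpose (frame_mat b)", simplified])
  finally have "(covolume (span L) L)\<^sup>2 = det (gram b)" by (simp add: det_gram)
  moreover have "det (gram b) > 0" using b(2) by (simp add: det_gram)
  ultimately show thesis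
    using that det_gram_Ints[OF b(1)] det_gram_scaleR_dual[OF b(1,2)] by blast
qed

section \<open>The ergodization time\<close>

text \<open>The change of variables formula of the library requires a well-ordered index type; this
  copy of a finite type provides one of the right cardinality.\<close>

typedef 'a ranked = "UNIV :: 'a set" by simp

instance ranked :: (finite) finite
  by standard (metis finite_class.finite_UNIV finite_imageI type_definition.Abs_image type_definition_ranked)

instantiation ranked :: (finite) wellorder
begin

definition less_eq_ranked :: "'a ranked \<Rightarrow> 'a ranked \<Rightarrow> bool" where
  "x \<le> y \<longleftrightarrow> to_nat (Rep_ranked x) \<le> to_nat (Rep_ranked y)"

definition less_ranked :: "'a ranked \<Rightarrow> 'a ranked \<Rightarrow> bool" where
  "x < y \<longleftrightarrow> to_nat (Rep_ranked x) < to_nat (Rep_ranked y)"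

instance
proof
  fix P :: "'a ranked \<Rightarrow> bool" and a
  assume step: "\<And>x. (\<And>y. y < x \<Longrightarrow> P y) \<Longrightarrow> P x"
  show "P a"
  proof (induction a rule: measure_induct_rule[where f = "\<lambda>x. to_nat (Rep_ranked x)"])
    case (less x)
    show ?case by (rule step) (simp add: less.IH less_ranked_def)
  qed
qed (auto simp: less_eq_ranked_def less_ranked_def Rep_ranked_inject)

end

lemma card_ranked: "CARD('a ranked) = CARD('a)"
  using type_definition.card[OF type_definition_ranked] .

text \<open>The selected orthonormal basis of \<open>span L\<close> and one of the orthogonal
  complement together have \<open>DIM('a)\<close> elements, so any index type of that size can
  number them.\<close>

lemma ex_volume_frame:
  fixes L :: "'a::euclidean_space set"
  assumes "integral_lattice L" and card: "CARD('m::finite) = DIM('a)"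
  obtains \<pi> :: "'m::finite \<Rightarrow> 'a" and S where "volume_frame L \<pi> S"
proof -
  interpret integral_lattice L by fact
  define E where "E = (SOME E. orthonormal_basis_of (span L) E)"
  have "\<exists>E. orthonormal_basis_of (span L) E"
    using orthonormal_basis_subspace[OF subspace_span[of L]] unfolding orthonormal_basis_of_def by metis
  then have "orthonormal_basis_of (span L) E" unfolding E_def by (rule someI_ex)
  then have E: "pairwise orthogonal E" "\<And>e. e \<in> E \<Longrightarrow> norm e = 1" "span E = span L"
    by (auto simp: orthonormal_basis_of_def)
  obtain E' where E': "E' \<subseteq> orthogonal_comp (span L)" "pairwise orthogonal E'"
    "\<And>e. e \<in> E' \<Longrightarrow> norm e = 1" "span E' = orthogonal_comp (span L)"
    using orthonormal_basis_subspace[OF subspace_orthogonal_comp] by metis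
  have cross: "orthogonal x y" if "x \<in> E" "y \<in> E'" for x y
    using that E'(1) span_base[OF that(1)] unfolding E(3) orthogonal_comp_def
    by (auto simp: orthogonal_commute)
  have cross': "orthogonal y x" if "x \<in> E" "y \<in> E'" for x y
    using cross[OF that] by (simp add: orthogonal_commute)
  have norm1: "norm x = 1" if "x \<in> E \<union> E'" for x using that E(2) E'(3) by auto
  have orth: "pairwise orthogonal (E \<union> E')"
    using E(1) E'(2) cross cross' by (auto simp: pairwise_def)
  have "0 \<notin> E \<union> E'" using norm1[of 0] by auto
  with orth have ind: "independent (E \<union> E')" by (rule pairwise_orthogonal_independent)
  have "x \<in> span (E \<union> E')" for x
  proof -
    have "x \<in> span L + orthogonal_comp (span L)"
      using subspace_sum_orthogonal_comp[OF subspace_span[of L]] by simp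
    then show ?thesis unfolding span_Un E(3) E'(4) by (auto elim!: set_plus_elim)
  qed
  then have "span (E \<union> E') = UNIV" by auto
  then have "card (E \<union> E') = DIM('a)"
    using ind dim_eq_card_independent[OF ind] by (metis dim_span dim_UNIV)
  then have "\<exists>\<pi>. bij_betw \<pi> (UNIV :: 'm set) (E \<union> E')"
    using card independent_imp_finite[OF ind] by (intro finite_same_card_bij) auto
  then obtain \<pi> :: "'m \<Rightarrow> 'a" where \<pi>: "bij_betw \<pi> UNIV (E \<union> E')" ..
  define S where "S = \<pi> -` E"
  have S: "\<pi> ` S = E" using \<pi> by (auto simp: S_def bij_betw_def)
  have "volume_frame L \<pi> S"
  proof
    fix i j
    show "\<pi> i \<bullet> \<pi> j = (if i = j then 1 else 0)"
    proof (cases "i = j")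
      case True
      have "norm (\<pi> i) = 1" using norm1 \<pi> by (auto simp: bij_betw_def)
      then show ?thesis using True by (simp add: norm_eq_1)
    next
      case False
      then have "\<pi> i \<noteq> \<pi> j" using \<pi> by (auto simp: bij_betw_def inj_def)
      moreover have "\<pi> i \<in> E \<union> E'" "\<pi> j \<in> E \<union> E'" using \<pi> by (auto simp: bij_betw_def)
      ultimately show ?thesis using False orth by (auto simp: pairwise_def orthogonal_def)
    qed
  qed (simp_all add: card S E(3) E_def[symmetric])
  then show thesis by (rule that)
qed

lemma countable_int_vecs: "countable (int_vecs :: (real ^ 'n) set)"
proof -
  have "k \<in> range (\<lambda>f. (\<chi> i. of_int (f i)) :: real ^ 'n)" if "k \<in> int_vecs" for k
    using that by (intro range_eqI[of _ _ "\<lambda>i. \<lfloor>k $ i\<rfloor>"]) (auto simp: int_vecs_def vec_eq_iff)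
  then have "(int_vecs :: (real ^ 'n) set) \<subseteq> range (\<lambda>f. \<chi> i. of_int (f i))" by blast
  then show ?thesis by (rule countable_subset) simp
qed

lemma finite_int_vecs_infnorm_le: "finite {k \<in> int_vecs :: (real ^ 'n) set. infnorm k \<le> Q}"
proof -
  have "{k \<in> int_vecs. infnorm k \<le> Q} \<subseteq>
    (\<lambda>f. (\<chi> i. of_int (f i)) :: real ^ 'n) ` (\<Pi>\<^sub>E i\<in>UNIV. {- \<lceil>Q\<rceil>..\<lceil>Q\<rceil>})"
  proof
    fix k :: "real ^ 'n" assume k: "k \<in> {k \<in> int_vecs. infnorm k \<le> Q}"
    have "- \<lceil>Q\<rceil> \<le> \<lfloor>k $ i\<rfloor> \<and> \<lfloor>k $ i\<rfloor> \<le> \<lceil>Q\<rceil>" for i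
      using k component_le_infnorm_cart[of k i] by (auto simp: le_floor_iff) linarith+
    moreover have "k = (\<chi> i. of_int \<lfloor>k $ i\<rfloor>)"
      using k by (auto simp: int_vecs_def vec_eq_iff)
    ultimately show "k \<in> (\<lambda>f. \<chi> i. of_int (f i)) ` (\<Pi>\<^sub>E i\<in>UNIV. {- \<lceil>Q\<rceil>..\<lceil>Q\<rceil>})"
      by (intro image_eqI[of _ _ "\<lambda>i. \<lfloor>k $ i\<rfloor>"]) auto
  qed
  then show ?thesis by (rule finite_subset) (intro finite_imageI finite_PiE; simp)
qed

lemma lattice_const_dual:
  fixes \<alpha> :: "real ^ 'n"
  shows lattice_const_ge_1: "lattice_const \<alpha> \<ge> 1"
    and lattice_const_scaleR_dual:
      "y \<in> rat_hull \<alpha> \<Longrightarrow> (\<And>l. l \<in> rat_lattice \<alpha> \<Longrightarrow> y \<bullet> l \<in> \<int>) \<Longrightarrow> lattice_const \<alpha> *\<^sub>R y \<in> rat_lattice \<alpha>"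
proof -
  obtain \<pi> :: "'n ranked \<Rightarrow> real ^ 'n" and S where vf: "volume_frame (rat_lattice \<alpha>) \<pi> S"
    using ex_volume_frame[OF integral_lattice_rat_lattice, where 'm = "'n ranked"]
    by (auto simp: card_ranked)
  have "countable (rat_lattice \<alpha>)"
    by (rule countable_subset[OF _ countable_int_vecs]) (auto simp: rat_lattice_eq)
  from covolume_sq[OF vf this, unfolded span_rat_lattice, folded lattice_const_def]
  obtain d where d: "d \<in> \<int>" "d > 0" "lattice_const \<alpha> = d"
    "\<And>y. y \<in> rat_hull \<alpha> \<Longrightarrow> (\<And>l. l \<in> rat_lattice \<alpha> \<Longrightarrow> y \<bullet> l \<in> \<int>) \<Longrightarrow> d *\<^sub>R y \<in> rat_lattice \<alpha>"
    by blast
  show "lattice_const \<alpha> \<ge> 1" using d(1-3) by (auto elim!: Ints_cases)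
  show "y \<in> rat_hull \<alpha> \<Longrightarrow> (\<And>l. l \<in> rat_lattice \<alpha> \<Longrightarrow> y \<bullet> l \<in> \<int>) \<Longrightarrow> lattice_const \<alpha> *\<^sub>R y \<in> rat_lattice \<alpha>"
    using d(3,4) by simp
qed

lemma inverse_le_Psi:
  assumes "k \<in> rat_lattice \<alpha>" "k \<noteq> 0" "infnorm k \<le> Q"
  shows "inverse \<bar>k \<bullet> \<alpha>\<bar> \<le> Psi \<alpha> Q"
  unfolding Psi_def
proof (rule Max_ge)
  have "{inverse \<bar>k \<bullet> \<alpha>\<bar> |k. k \<in> rat_lattice \<alpha> \<and> 0 < infnorm k \<and> infnorm k \<le> Q} \<subseteq>
      (\<lambda>k. inverse \<bar>k \<bullet> \<alpha>\<bar>) ` {k \<in> int_vecs. infnorm k \<le> Q}"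
    by (auto simp: rat_lattice_eq)
  then show "finite {inverse \<bar>k \<bullet> \<alpha>\<bar> |k. k \<in> rat_lattice \<alpha> \<and> 0 < infnorm k \<and> infnorm k \<le> Q}"
    by (rule finite_subset) (intro finite_imageI finite_int_vecs_infnorm_le)
  show "inverse \<bar>k \<bullet> \<alpha>\<bar> \<in> {inverse \<bar>k \<bullet> \<alpha>\<bar> |k. k \<in> rat_lattice \<alpha> \<and> 0 < infnorm k \<and> infnorm k \<le> Q}"
    using assms by (auto simp: infnorm_pos_lt)
qed

text \<open>This is the requirement of \<open>covering\<close> for 2 * H = d^2 d!, with equality at
  d = 0 and d = 1. From d = 2 on, the new factor \<open>Suc d\<close> of the factorial pays for the
  factor 3.\<close>

lemma power3_le_square_fact: "3 ^ d \<le> 2 * (real d)\<^sup>2 * fact d + 1"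
proof (induction d)
  case (Suc d)
  consider "d = 0" | "d = 1" | "d \<ge> 2" by linarith
  then show ?case
  proof cases
    case 3
    have "1 \<le> (fact d :: real)" by simp
    then have "1 * 1 \<le> (1 + 2 * real d) * fact d" by (intro mult_mono) auto
    then have f: "1 \<le> (1 + 2 * real d) * fact d" by simp
    have "3 ^ Suc d \<le> 3 * (2 * (real d)\<^sup>2 * fact d + 1)" using Suc by simp
    also have "\<dots> \<le> 3 * (2 * (real (Suc d))\<^sup>2 * fact d) + 1"
      using f by (simp add: power2_eq_square algebra_simps)
    also have "3 * (2 * (real (Suc d))\<^sup>2 * fact d) \<le> real (Suc d) * (2 * (real (Suc d))\<^sup>2 * fact d)"
      using 3 by (intro mult_right_mono) auto
    finally show ?thesis by (simp add: algebra_simps)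
  qed (simp_all add: power2_eq_square)
qed simp

theorem theorem1:
  fixes \<alpha> :: "real ^ 'n" and \<delta> :: real
  assumes "CARD('n) \<ge> 2"
    and "\<alpha> \<noteq> 0"
    and "\<exists>i. \<alpha> $ i = 1"
    and "\<delta> > 0"
    and "\<delta> \<le> (real (dim (rat_hull \<alpha>)))\<^sup>2 / ((real CARD('n) + 2) * min_lattice_norm \<alpha>)"
  shows "ergodization_time \<alpha> \<delta> \<le> dim_const \<alpha> * Psi \<alpha> (2 * dim_const \<alpha> * inverse \<delta>)"
proof -
  let ?F = "rat_hull \<alpha>" and ?L = "rat_lattice \<alpha>"
  define d C D m Q P where "d = dim ?F" and "C = lattice_const \<alpha>" and "D = dim_const \<alpha>"
    and "m = min_lattice_norm \<alpha>" and "Q = 2 * D * inverse \<delta>" and "P = Psi \<alpha> Q"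
  define H where "H = (real d)\<^sup>2 * fact d / 2"
  define T where "T = D * P"
  note \<delta> = \<open>\<delta> > 0\<close>
  interpret integral_lattice ?L by (rule integral_lattice_rat_lattice)
  have C: "C \<ge> 1" unfolding C_def by (rule lattice_const_ge_1)
  have D: "D = 2 * H * C" by (simp add: D_def dim_const_def H_def d_def C_def)
  have "d \<noteq> 0" using \<open>\<alpha> \<noteq> 0\<close> mem_rat_hull[of \<alpha>] unfolding d_def by (auto simp: dim_eq_0)
  then have d: "d \<ge> 1" by simp
  have H: "H > 0" using d by (simp add: H_def)
  have D0: "D > 0" using H C by (simp add: D)
  have \<delta>_le: "\<delta> \<le> (real d)\<^sup>2 / ((real CARD('n) + 2) * m)" using assms(5) by (simp add: d_def m_def)
  \<comment> \<open>Division by 0 gives 0, so m = 0 would also make the upper bound on \<delta>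
    nonpositive.\<close>
  have m: "m > 0"
  proof (rule ccontr)
    assume "\<not> m > 0"
    then have "(real CARD('n) + 2) * m \<le> 0" by (simp add: mult_nonneg_nonpos)
    then have "(real d)\<^sup>2 / ((real CARD('n) + 2) * m) \<le> 0" by (simp add: divide_nonneg_nonpos)
    then show False using \<delta> \<delta>_le by simp
  qed
  \<comment> \<open>Strictness spares attainment of the infimum m: some nonzero lattice vector has
    norm below Q, so the maximum in \<open>Psi\<close> is over a nonempty set and P > 0.\<close>
  have "m < Q"
  proof -
    have "\<delta> * ((real CARD('n) + 2) * m) \<le> (real d)\<^sup>2"
      using \<delta>_le m by (simp add: pos_le_divide_eq)
    moreover have "\<delta> * (1 * m) < \<delta> * ((real CARD('n) + 2) * m)"
      using \<delta> m by (intro mult_strict_left_mono mult_strict_right_mono) auto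
    moreover have "(real d)\<^sup>2 * 1 * 1 \<le> (real d)\<^sup>2 * fact d * C"
      using C by (intro mult_mono) auto
    ultimately have "\<delta> * m < 2 * D" using D0 by (simp add: D H_def)
    then show ?thesis using \<delta> by (simp add: Q_def field_simps)
  qed
  have "\<not> ?L \<subseteq> {0}"
    using mem_rat_hull[of \<alpha>] \<open>\<alpha> \<noteq> 0\<close> span_mono[of ?L "{0}"] unfolding span_rat_lattice by auto
  then have "infnorm ` (?L - {0}) \<noteq> {}" by auto
  from cInf_lessD[OF this, of Q] \<open>m < Q\<close>
  obtain k1 where k1: "k1 \<in> ?L" "k1 \<noteq> 0" "infnorm k1 < Q"
    unfolding m_def min_lattice_norm_def by auto
  have "0 < inverse \<bar>k1 \<bullet> \<alpha>\<bar>" using inner_rat_lattice_nonzero[OF k1(1,2)] by simp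
  also have "\<dots> \<le> P" unfolding P_def using k1 by (intro inverse_le_Psi) auto
  finally have P: "P > 0" .
  have T: "T > 0" using D0 P by (simp add: T_def)

  \<comment> \<open>The time window is centred at 0 to make K symmetric; the shift by T / 2 in the
    covering argument restores [0, T].\<close>
  define K where "K = {t *\<^sub>R \<alpha> + y |t y. \<bar>t\<bar> \<le> T / 2 \<and> y \<in> ?F \<and> infnorm y \<le> \<delta>}"
  have K_I: "t *\<^sub>R \<alpha> + y \<in> K" if "\<bar>t\<bar> \<le> T / 2" "y \<in> ?F" "infnorm y \<le> \<delta>" for t y
    using that unfolding K_def by blast
  have F0: "0 \<in> ?F" using subspace_rat_hull[of \<alpha>] by (rule subspace_0)
  have K_flow: "t *\<^sub>R \<alpha> \<in> K" if "\<bar>t\<bar> \<le> T / 2" for t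
    using K_I[OF that F0] \<delta> by (simp add: infnorm_0)
  \<comment> \<open>For x = 0 the coefficient is 0 by the convention for division, and the claim
    becomes 0 \<in> K.\<close>
  have K_unit: "(\<delta> / infnorm x) *\<^sub>R x \<in> K" if x: "x \<in> ?F" for x
  proof -
    have "infnorm ((\<delta> / infnorm x) *\<^sub>R x) \<le> \<delta>"
      using \<delta> infnorm_pos_le[of x] by (cases "infnorm x = 0") (auto simp: infnorm_mul infnorm_0)
    then show ?thesis
      using K_I[of 0 "(\<delta> / infnorm x) *\<^sub>R x"] T subspace_scale[OF subspace_rat_hull[of \<alpha>] x] by simp
  qed
  interpret lattice_body ?L K H
  proof
    show "convex K"
    proof (rule convexI)
      fix x y u v :: real and x' y' :: "real ^ 'n"
      assume "x' \<in> K" "y' \<in> K" and uv: "0 \<le> u" "0 \<le> v" "u + v = 1"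
      then obtain s a t b where s: "x' = s *\<^sub>R \<alpha> + a" "\<bar>s\<bar> \<le> T / 2" "a \<in> ?F" "infnorm a \<le> \<delta>"
        and t: "y' = t *\<^sub>R \<alpha> + b" "\<bar>t\<bar> \<le> T / 2" "b \<in> ?F" "infnorm b \<le> \<delta>"
        unfolding K_def by blast
      have "u *\<^sub>R x' + v *\<^sub>R y' = (u * s + v * t) *\<^sub>R \<alpha> + (u *\<^sub>R a + v *\<^sub>R b)"
        by (simp add: s t algebra_simps)
      moreover have "\<bar>u * s + v * t\<bar> \<le> T / 2"
      proof -
        have "\<bar>u * s + v * t\<bar> \<le> u * \<bar>s\<bar> + v * \<bar>t\<bar>"
          using uv by (metis abs_mult abs_of_nonneg abs_triangle_ineq)
        also have "\<dots> \<le> T / 2" using s t uv by (intro convex_bound_le) auto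
        finally show ?thesis .
      qed
      moreover have "infnorm (u *\<^sub>R a + v *\<^sub>R b) \<le> \<delta>"
      proof -
        have "infnorm (u *\<^sub>R a + v *\<^sub>R b) \<le> u * infnorm a + v * infnorm b"
          using uv infnorm_triangle[of "u *\<^sub>R a" "v *\<^sub>R b"] by (simp add: infnorm_mul)
        also have "\<dots> \<le> \<delta>" using s t uv by (intro convex_bound_le) auto
        finally show ?thesis .
      qed
      moreover have "u *\<^sub>R a + v *\<^sub>R b \<in> ?F"
        using s t subspace_rat_hull[of \<alpha>] by (simp add: subspace_add subspace_scale)
      ultimately show "u *\<^sub>R x' + v *\<^sub>R y' \<in> K" using K_I by simp
    qed
    show "- x \<in> K" if "x \<in> K" for x
    proof -
      from that obtain s a where s: "x = s *\<^sub>R \<alpha> + a" "\<bar>s\<bar> \<le> T / 2" "a \<in> ?F" "infnorm a \<le> \<delta>"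
        unfolding K_def by blast
      have "- x = (- s) *\<^sub>R \<alpha> + (- a)" by (simp add: s)
      then show ?thesis
        using K_I[of "- s" "- a"] s subspace_neg[OF subspace_rat_hull[of \<alpha>]] by (simp add: infnorm_neg)
    qed
    show "K \<noteq> {}" using K_unit[OF F0] by auto
    show "H > 0" by (rule H)
    show "K \<subseteq> span ?L"
      unfolding span_rat_lattice K_def
      using subspace_rat_hull[of \<alpha>] mem_rat_hull[of \<alpha>] by (auto intro!: subspace_add subspace_scale)
    show "\<exists>s\<ge>0. \<exists>k\<in>K. x = s *\<^sub>R k" if x: "x \<in> span ?L" for x
    proof (cases "x = 0")
      case True
      then show ?thesis using K_flow[of 0] T by (intro exI[of _ 0]) auto
    next
      case False
      then have "infnorm x > 0" by (simp add: infnorm_pos_lt)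
      then show ?thesis
        using K_unit[of x] x \<delta> unfolding span_rat_lattice
        by (intro exI[of _ "infnorm x / \<delta>"] conjI bexI[of _ "(\<delta> / infnorm x) *\<^sub>R x"]) auto
    qed
    show "\<exists>k\<in>K. H \<le> y \<bullet> k" if y: "y \<in> span ?L" "y \<noteq> 0" "\<forall>l\<in>?L. y \<bullet> l \<in> \<int>" for y
    proof -
      have yF: "y \<in> ?F" using y(1) by (simp add: span_rat_lattice)
      have Cy: "C *\<^sub>R y \<in> ?L" unfolding C_def using yF y(3) by (intro lattice_const_scaleR_dual) auto
      have Cy0: "C *\<^sub>R y \<noteq> 0" using C y(2) by simp
      show ?thesis
      proof (cases "infnorm (C *\<^sub>R y) \<le> Q")
        case True
        have "inverse \<bar>C *\<^sub>R y \<bullet> \<alpha>\<bar> \<le> P" unfolding P_def using Cy Cy0 True by (rule inverse_le_Psi)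
        moreover have "\<bar>C *\<^sub>R y \<bullet> \<alpha>\<bar> > 0" using inner_rat_lattice_nonzero[OF Cy Cy0] by simp
        ultimately have "1 \<le> P * \<bar>C *\<^sub>R y \<bullet> \<alpha>\<bar>" by (simp add: field_simps)
        then have "H * 1 \<le> H * (P * \<bar>C *\<^sub>R y \<bullet> \<alpha>\<bar>)" using H by (intro mult_left_mono) auto
        \<comment> \<open>T = D * P = 2 * H * C * P; the factor C cancels against the scaling of y.
          The sign then selects the end of the time window on which the product with y is
          positive.\<close>
        also have "\<dots> = T / 2 * \<bar>y \<bullet> \<alpha>\<bar>" using C by (simp add: T_def D abs_mult)
        also have "\<dots> = y \<bullet> ((sgn (y \<bullet> \<alpha>) * (T / 2)) *\<^sub>R \<alpha>)" by (simp add: abs_sgn)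
        finally have "H \<le> y \<bullet> ((sgn (y \<bullet> \<alpha>) * (T / 2)) *\<^sub>R \<alpha>)" by simp
        moreover have "(sgn (y \<bullet> \<alpha>) * (T / 2)) *\<^sub>R \<alpha> \<in> K"
          using T by (intro K_flow) (auto simp: abs_mult sgn_if)
        ultimately show ?thesis by blast
      next
        case False
        have ypos: "infnorm y > 0" using y(2) by (simp add: infnorm_pos_lt)
        \<comment> \<open>Q = 4 * H * C / \<delta>, so \<delta> * \<open>infnorm y\<close> exceeds 4
          * H. The test vector is y scaled to sup norm \<delta>; its product with y is at least
          \<delta> * \<open>infnorm y\<close>, since the Euclidean norm dominates the sup
          norm.\<close>
        have "Q < C * infnorm y" using False C by (simp add: infnorm_mul)
        then have "C * (4 * H) < C * (\<delta> * infnorm y)"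
          using \<delta> by (simp add: Q_def D field_simps)
        then have "4 * H < \<delta> * infnorm y" using C by (simp add: mult_less_cancel_left_pos)
        then have "H \<le> \<delta> / infnorm y * (infnorm y * infnorm y)" using H ypos by simp
        also have "\<dots> \<le> \<delta> / infnorm y * (norm y * norm y)"
          using \<delta> ypos infnorm_le_norm[of y] by (intro mult_left_mono mult_mono) auto
        also have "\<dots> = y \<bullet> ((\<delta> / infnorm y) *\<^sub>R y)"
          by (simp add: power2_norm_eq_inner[symmetric] power2_eq_square)
        finally show ?thesis using K_unit[OF yF] by blast
      qed
    qed
  qed

  have cover: "\<exists>t l. 0 \<le> t \<and> t \<le> T \<and> l \<in> ?L \<and> infnorm (x - t *\<^sub>R \<alpha> - l) \<le> \<delta>" if x: "x \<in> ?F" for x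
  proof -
    have "x - (T / 2) *\<^sub>R \<alpha> \<in> span ?L"
      unfolding span_rat_lattice using x mem_rat_hull[of \<alpha>] subspace_rat_hull[of \<alpha>]
      by (intro subspace_diff subspace_scale)
    moreover have "3 ^ dim ?L \<le> 4 * H + 1"
      using power3_le_square_fact[of d] by (simp add: H_def d_def span_rat_lattice[symmetric] ac_simps)
    ultimately obtain l k where l: "l \<in> ?L" "k \<in> K" "x - (T / 2) *\<^sub>R \<alpha> = l + k"
      by (rule covering)
    then obtain t y where k: "k = t *\<^sub>R \<alpha> + y" "\<bar>t\<bar> \<le> T / 2" "infnorm y \<le> \<delta>" unfolding K_def by blast
    have "x - (t + T / 2) *\<^sub>R \<alpha> - l = y" using l(3) by (simp add: k algebra_simps)
    then show ?thesis using k l(1) by (intro exI[of _ "t + T / 2"] exI[of _ l]) auto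
  qed

  have flow: "linear_flow \<alpha> t (torus_rel \<alpha> `` {0}) = torus_rel \<alpha> `` {t *\<^sub>R \<alpha>}" for t
  proof (intro set_eqI iffI)
    fix z assume "z \<in> linear_flow \<alpha> t (torus_rel \<alpha> `` {0})"
    then obtain w where "z = w + t *\<^sub>R \<alpha>" "w \<in> ?F" "- w \<in> ?L"
      by (auto simp: linear_flow_def torus_rel_def)
    then show "z \<in> torus_rel \<alpha> `` {t *\<^sub>R \<alpha>}"
      using subspace_rat_hull[of \<alpha>] mem_rat_hull[of \<alpha>]
      by (auto simp: torus_rel_def intro!: subspace_add subspace_scale)
  next
    fix z assume "z \<in> torus_rel \<alpha> `` {t *\<^sub>R \<alpha>}"
    then have z: "z \<in> ?F" "t *\<^sub>R \<alpha> - z \<in> ?L" by (auto simp: torus_rel_def)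
    then have "z - t *\<^sub>R \<alpha> \<in> ?F" using subspace_rat_hull[of \<alpha>] mem_rat_hull[of \<alpha>]
      by (auto intro!: subspace_diff subspace_scale)
    then have "z - t *\<^sub>R \<alpha> \<in> torus_rel \<alpha> `` {0}" using z F0 by (auto simp: torus_rel_def)
    then show "z \<in> linear_flow \<alpha> t (torus_rel \<alpha> `` {0})"
      unfolding linear_flow_def by (intro image_eqI[of _ _ "z - t *\<^sub>R \<alpha>"]) auto
  qed
  have self: "x \<in> torus_rel \<alpha> `` {x}" if "x \<in> ?F" for x
    using that zero_mem by (auto simp: torus_rel_def)
  have t\<alpha>: "t *\<^sub>R \<alpha> \<in> ?F" for t using mem_rat_hull[of \<alpha>] subspace_rat_hull[of \<alpha>] by (simp add: subspace_scale)
  have "delta_dense (torus \<alpha>) (torus_dist \<alpha>) \<delta> (flow_orbit \<alpha> T)"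
    unfolding delta_dense_def
  proof (intro conjI ballI)
    show "flow_orbit \<alpha> T \<subseteq> torus \<alpha>"
      using t\<alpha> by (auto simp: flow_orbit_def flow torus_def intro: quotientI)
    fix A assume "A \<in> torus \<alpha>"
    then obtain x where x: "x \<in> ?F" "A = torus_rel \<alpha> `` {x}" by (auto simp: torus_def elim: quotientE)
    obtain t l where t: "0 \<le> t" "t \<le> T" "l \<in> ?L" "infnorm (x - t *\<^sub>R \<alpha> - l) \<le> \<delta>"
      using cover[OF x(1)] by blast
    let ?B = "torus_rel \<alpha> `` {t *\<^sub>R \<alpha>}"
    have "torus_dist \<alpha> A ?B \<le> infnorm (x - t *\<^sub>R \<alpha> - l)"
      unfolding torus_dist_def
    proof (rule cInf_lower)
      show "infnorm (x - t *\<^sub>R \<alpha> - l) \<in> {infnorm (x - y - l) |x y l. x \<in> A \<and> y \<in> ?B \<and> l \<in> ?L}"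
        using self[OF x(1)] self[OF t\<alpha>] x(2) t(3) by blast
      show "bdd_below {infnorm (x - y - l) |x y l. x \<in> A \<and> y \<in> ?B \<and> l \<in> ?L}"
        by (intro bdd_belowI[of _ 0]) (auto simp: infnorm_pos_le)
    qed
    moreover have "?B \<in> flow_orbit \<alpha> T" using t(1,2) by (auto simp: flow_orbit_def flow)
    ultimately show "\<exists>B\<in>flow_orbit \<alpha> T. torus_dist \<alpha> A B \<le> \<delta>" using t(4) by force
  qed
  then have "ergodization_time \<alpha> \<delta> \<le> T"
    unfolding ergodization_time_def using T
    by (intro cInf_lower) (auto intro!: bdd_belowI[of _ 0])
  then show ?thesis by (simp add: T_def P_def Q_def D_def)
qed

end
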